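(* Let $P$ and $Q$ be probability distributions on a measurable space $(\mathcal{X},\mathcal{F})$. Let $\mathcal{F}_1\subseteq\mathcal{F}_2\subseteq\cdots\subseteq\mathcal{F}$ be an increasing family of $\sigma$-algebras, and let $\mathcal{F}_\infty=\sigma\left(\bigcup_{n=1}^\infty\mathcal{F}_n\right)$ be the smallest $\sigma$-algebra containing them. Then for any order $\alpha\in(0,\infty]$ $$\lim_{n\to\infty}D_\alpha(P_{|\mathcal{F}_n}\|Q_{|\mathcal{F}_n})=D_\alpha(P_{|\mathcal{F}_\infty}\|Q_{|\mathcal{F}_\infty}).$$
   Context: $P_{|\mathcal{G}}$ denotes the restriction of $P$ to the sub-$\sigma$-algebra $\mathcal{G}\subseteq\mathcal{F}$. Rényi divergence: let $P,Q$ be probability distributions on a measurable space with densities $p,q$ with respect to a dominating $\sigma$-finite measure $\mu$ (whose choice is immaterial). For $\alpha\in(0,1)\cup(1,\infty)$, $D_\alpha(P\|Q)=\frac{1}{\alpha-1}\ln\int p^\alpha q^{1-\alpha}\,d\mu\in[0,\infty]$, where for $\alpha>1$ one reads $p^\alpha q^{1-\alpha}$ as $p^\alpha/q^{\alpha-1}$ with the conventions $0/0=0$ and $x/0=\infty$ for $x>0$. Further $D_1(P\|Q)=\lim_{\alpha\uparrow1}D_\alpha(P\|Q)$ and $D_\infty(P\|Q)=\lim_{\alpha\uparrow\infty}D_\alpha(P\|Q)$ (these limits always exist in $[0,\infty]$). *)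

theory Defs
  imports "HOL-Probability.Probability"
begin

definition ln_ennreal :: "ennreal \<Rightarrow> ereal" where
  "ln_ennreal x = (if x = 0 then -\<infinity> else if x = \<infinity> then \<infinity> else ereal (ln (enn2real x)))"

text \<open>
  The function \<open>x\<^sup>\<alpha> y\<^sup>1\<^sup>-\<^sup>\<alpha>\<close> for \<open>x, y \<ge> 0\<close>. Division on \<^typ>\<open>ennreal\<close> satisfies
  \<open>0 / 0 = 0\<close> and \<open>x / 0 = \<infinity>\<close> for \<open>x > 0\<close>, which are the conventions wanted for \<open>\<alpha> > 1\<close>.
\<close>

definition renyi_integrand :: "real \<Rightarrow> real \<Rightarrow> real \<Rightarrow> ennreal" where
  "renyi_integrand \<alpha> x y =
     (if \<alpha> < 1 then ennreal (x powr \<alpha> * y powr (1 - \<alpha>))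
      else ennreal (x powr \<alpha>) / ennreal (y powr (\<alpha> - 1)))"

definition renyi_of_densities ::
  "real \<Rightarrow> 'a measure \<Rightarrow> ('a \<Rightarrow> real) \<Rightarrow> ('a \<Rightarrow> real) \<Rightarrow> ereal" where
  "renyi_of_densities \<alpha> \<mu> p q =
     ereal (1 / (\<alpha> - 1)) * ln_ennreal (\<integral>\<^sup>+x. renyi_integrand \<alpha> (p x) (q x) \<partial>\<mu>)"

definition sum_measure :: "'a measure \<Rightarrow> 'a measure \<Rightarrow> 'a measure" where
  "sum_measure P Q = measure_of (space P) (sets P) (\<lambda>A. emeasure P A + emeasure Q A)"

text \<open>
  Simple orders \<open>\<alpha> \<in> (0,1) \<union> (1,\<infinity>)\<close>. The dominating measure is taken to be \<open>P + Q\<close>; by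
  \<open>renyi_simple_eq\<close> below, any other sigma-finite dominating measure and any versions of the
  densities yield the same value.
\<close>

definition renyi_simple :: "real \<Rightarrow> 'a measure \<Rightarrow> 'a measure \<Rightarrow> ereal" where
  "renyi_simple \<alpha> P Q =
     (let \<mu> = sum_measure P Q in
      renyi_of_densities \<alpha> \<mu> (\<lambda>x. enn2real (RN_deriv \<mu> P x)) (\<lambda>x. enn2real (RN_deriv \<mu> Q x)))"

definition renyi_divergence :: "ereal \<Rightarrow> 'a measure \<Rightarrow> 'a measure \<Rightarrow> ereal" where
  "renyi_divergence \<alpha> P Q =
     (if \<alpha> = 1 then Lim (at_left 1) (\<lambda>a. renyi_simple a P Q)
      else if \<alpha> = \<infinity> then Lim at_top (\<lambda>a. renyi_simple a P Q)
      else renyi_simple (real_of_ereal \<alpha>) P Q)"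

lemma sets_sum_measure [simp, measurable_cong]: "sets (sum_measure P Q) = sets P"
  by (simp add: sum_measure_def)

lemma space_sum_measure [simp]: "space (sum_measure P Q) = space P"
  by (simp add: sum_measure_def)

lemma emeasure_sum_measure:
  assumes "sets Q = sets P" "A \<in> sets P"
  shows "emeasure (sum_measure P Q) A = emeasure P A + emeasure Q A"
proof (rule emeasure_measure_of[OF sum_measure_def])
  show "countably_additive (sets (sum_measure P Q)) (\<lambda>A. emeasure P A + emeasure Q A)"
    unfolding countably_additive_def
  proof (intro allI impI)
    fix A :: "nat \<Rightarrow> 'a set"
    assume A: "range A \<subseteq> sets (sum_measure P Q)" "disjoint_family A"
    have "(\<Sum>i. emeasure P (A i) + emeasure Q (A i)) =
        (\<Sum>i. emeasure P (A i)) + (\<Sum>i. emeasure Q (A i))"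
      by (rule suminf_add[symmetric]) auto
    also have "\<dots> = emeasure P (\<Union>i. A i) + emeasure Q (\<Union>i. A i)"
      using A assms by (simp add: suminf_emeasure)
    finally show "(\<Sum>i. emeasure P (A i) + emeasure Q (A i)) =
        emeasure P (\<Union>i. A i) + emeasure Q (\<Union>i. A i)" .
  qed
qed (use assms in \<open>auto simp: positive_def sets.space_closed\<close>)

lemma renyi_integrand_scale:
  assumes "0 \<le> h" "0 \<le> x" "0 \<le> y" "0 < \<alpha>" "\<alpha> \<noteq> 1"
  shows "renyi_integrand \<alpha> (h * x) (h * y) = ennreal h * renyi_integrand \<alpha> x y"
proof (cases "h = 0")
  case True
  then show ?thesis by (simp add: renyi_integrand_def)
next
  case False
  with assms have h: "0 < h" by simp
  show ?thesis
  proof (cases "\<alpha> < 1")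
    case True
    have "(h * x) powr \<alpha> * (h * y) powr (1 - \<alpha>)
        = (h powr \<alpha> * h powr (1 - \<alpha>)) * (x powr \<alpha> * y powr (1 - \<alpha>))"
      using assms by (simp add: powr_mult mult_ac)
    also have "h powr \<alpha> * h powr (1 - \<alpha>) = h"
      using h by (simp flip: powr_add)
    finally show ?thesis
      using True h by (simp add: renyi_integrand_def ennreal_mult)
  next
    case False
    with assms have a: "1 < \<alpha>" by simp
    have hp: "h powr \<alpha> = h * h powr (\<alpha> - 1)"
      using h by (simp add: powr_mult_base)
    show ?thesis
    proof (cases "y = 0")
      case True
      then show ?thesis
        using a h assms
        by (cases "x = 0")
          (auto simp: renyi_integrand_def ennreal_mult_top ennreal_mult_eq_top_iff
            ennreal_divide_eq_top_iff divide_ennreal_def ennreal_mult_eq_top_iff)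
    next
      case y: False
      have "(h * x) powr \<alpha> / (h * y) powr (\<alpha> - 1) = h * (x powr \<alpha> / y powr (\<alpha> - 1))"
        using assms h by (simp add: powr_mult hp)
      then show ?thesis
        using a h y assms
        by (simp add: renyi_integrand_def divide_ennreal ennreal_mult[symmetric])
    qed
  qed
qed

lemma renyi_integrand_measurable [measurable]:
  assumes [measurable]: "f \<in> borel_measurable M" "g \<in> borel_measurable M"
  shows "(\<lambda>x. renyi_integrand \<alpha> (f x) (g x)) \<in> borel_measurable M"
  unfolding renyi_integrand_def divide_ennreal_def by measurable

lemma renyi_simple_eq:
  fixes P Q \<mu> :: "'a measure" and p q :: "'a \<Rightarrow> real"
  assumes "prob_space P" "prob_space Q" "sigma_finite_measure \<mu>"
    and [measurable]: "p \<in> borel_measurable \<mu>" "q \<in> borel_measurable \<mu>"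
    and nonneg: "\<And>x. x \<in> space \<mu> \<Longrightarrow> 0 \<le> p x" "\<And>x. x \<in> space \<mu> \<Longrightarrow> 0 \<le> q x"
    and P: "P = density \<mu> (\<lambda>x. ennreal (p x))"
    and Q: "Q = density \<mu> (\<lambda>x. ennreal (q x))"
    and \<alpha>: "0 < \<alpha>" "\<alpha> \<noteq> 1"
  shows "renyi_simple \<alpha> P Q = renyi_of_densities \<alpha> \<mu> p q"
proof -
  interpret P: prob_space P by fact
  interpret Q: prob_space Q by fact
  interpret \<mu>: sigma_finite_measure \<mu> by fact
  define \<nu> where "\<nu> = sum_measure P Q"
  define h where "h x = p x + q x" for x
  have [measurable]: "h \<in> borel_measurable \<mu>" unfolding h_def by measurable
  have h0: "0 \<le> h x" if "x \<in> space \<mu>" for x using nonneg that by (simp add: h_def)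
  have sets_\<nu>: "sets \<nu> = sets \<mu>" and sets_P: "sets P = sets \<mu>" and sets_Q: "sets Q = sets \<mu>"
    by (simp_all add: \<nu>_def P Q)
  note [measurable_cong] = sets_\<nu>
  have emb: "emeasure \<nu> A = emeasure P A + emeasure Q A" if "A \<in> sets \<mu>" for A
    using emeasure_sum_measure[of Q P A] that sets_P sets_Q by (simp add: \<nu>_def)
  have \<nu>: "\<nu> = density \<mu> (\<lambda>x. ennreal (h x))"
  proof (rule measure_eqI)
    fix A assume "A \<in> sets \<nu>"
    then have A[measurable]: "A \<in> sets \<mu>" using sets_\<nu> by simp
    have "emeasure \<nu> A = (\<integral>\<^sup>+x. ennreal (p x) * indicator A x \<partial>\<mu>) +
        (\<integral>\<^sup>+x. ennreal (q x) * indicator A x \<partial>\<mu>)"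
      using emb[OF A] by (simp add: P Q emeasure_density)
    also have "\<dots> = (\<integral>\<^sup>+x. ennreal (p x) * indicator A x + ennreal (q x) * indicator A x \<partial>\<mu>)"
      by (rule nn_integral_add[symmetric]) measurable
    also have "\<dots> = (\<integral>\<^sup>+x. ennreal (h x) * indicator A x \<partial>\<mu>)"
      by (intro nn_integral_cong) (use nonneg in \<open>simp add: h_def distrib_right\<close>)
    finally show "emeasure \<nu> A = emeasure (density \<mu> (\<lambda>x. ennreal (h x))) A"
      by (simp add: emeasure_density)
  qed (simp add: sets_\<nu>)
  have "emeasure \<nu> (space \<nu>) = emeasure P (space P) + emeasure Q (space Q)"
    using emb[of "space \<mu>"] sets_eq_imp_space_eq[OF sets_\<nu>] sets_eq_imp_space_eq[OF sets_P]
      sets_eq_imp_space_eq[OF sets_Q] by simp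
  then interpret \<nu>: finite_measure \<nu>
    by (intro finite_measureI) (simp add: P.emeasure_space_1 Q.emeasure_space_1)
  have ac: "absolutely_continuous \<nu> P" "absolutely_continuous \<nu> Q"
    by (auto simp: absolutely_continuous_def null_sets_def sets_\<nu> sets_P sets_Q emb)
  have RN: "AE x in \<mu>. f x = h x * enn2real (RN_deriv \<nu> R x)"
    if R: "R = density \<mu> (\<lambda>x. ennreal (f x))" "prob_space R" "absolutely_continuous \<nu> R"
      and [measurable]: "f \<in> borel_measurable \<mu>" and f0: "\<And>x. x \<in> space \<mu> \<Longrightarrow> 0 \<le> f x"
    for R and f :: "'a \<Rightarrow> real"
  proof -
    interpret R: prob_space R by fact
    have [measurable]: "RN_deriv \<nu> R \<in> borel_measurable \<mu>"
      using borel_measurable_RN_deriv[of \<nu> R] sets_\<nu> measurable_cong_sets by blast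
    have "density \<nu> (RN_deriv \<nu> R) = R"
      using \<nu>.density_RN_deriv[OF R(3)] by (simp add: sets_\<nu> R(1))
    then have "density \<mu> (\<lambda>x. ennreal (h x) * RN_deriv \<nu> R x) = R"
      by (subst (asm) (1) \<nu>) (simp add: density_density_eq)
    then have "AE x in \<mu>. ennreal (f x) = ennreal (h x) * RN_deriv \<nu> R x"
      using R(1) by (intro \<mu>.density_unique_iff[THEN iffD1]) auto
    then show ?thesis
    proof (rule AE_mp, intro AE_I2 impI)
      fix x assume x: "x \<in> space \<mu>" "ennreal (f x) = ennreal (h x) * RN_deriv \<nu> R x"
      have "f x = enn2real (ennreal (f x))" using f0[OF x(1)] by simp
      also have "\<dots> = enn2real (ennreal (h x)) * enn2real (RN_deriv \<nu> R x)"
        unfolding x(2) by (rule enn2real_mult)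
      finally show "f x = h x * enn2real (RN_deriv \<nu> R x)" using h0[OF x(1)] by simp
    qed
  qed
  have [measurable]: "RN_deriv \<nu> R \<in> borel_measurable \<mu>" for R
    using borel_measurable_RN_deriv[of \<nu> R] sets_\<nu> measurable_cong_sets by blast
  let ?p = "\<lambda>x. enn2real (RN_deriv \<nu> P x)" and ?q = "\<lambda>x. enn2real (RN_deriv \<nu> Q x)"
  have "(\<integral>\<^sup>+x. renyi_integrand \<alpha> (?p x) (?q x) \<partial>\<nu>)
      = (\<integral>\<^sup>+x. renyi_integrand \<alpha> (?p x) (?q x) \<partial>density \<mu> (\<lambda>x. ennreal (h x)))"
    by (simp flip: \<nu>)
  also have "\<dots> = (\<integral>\<^sup>+x. ennreal (h x) * renyi_integrand \<alpha> (?p x) (?q x) \<partial>\<mu>)"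
    by (rule nn_integral_density) measurable
  also have "\<dots> = (\<integral>\<^sup>+x. renyi_integrand \<alpha> (h x * ?p x) (h x * ?q x) \<partial>\<mu>)"
    by (intro nn_integral_cong) (simp add: renyi_integrand_scale h0 \<alpha>)
  also have "\<dots> = (\<integral>\<^sup>+x. renyi_integrand \<alpha> (p x) (q x) \<partial>\<mu>)"
    using RN[OF P assms(1) ac(1)] RN[OF Q assms(2) ac(2)] nonneg
    by (intro nn_integral_cong_AE) auto
  finally show ?thesis
    by (simp add: renyi_simple_def renyi_of_densities_def Let_def flip: \<nu>_def)
qed

end

theory Submission
  imports Defs "HOL-Real_Asymp.Real_Asymp"
begin

text \<open>
  Young's inequality \<open>x\<^sup>a y\<^sup>1\<^sup>-\<^sup>a \<le> a t\<^sup>a\<^sup>-\<^sup>1 x + (1 - a) t\<^sup>a y\<close> for \<open>a < 1\<close>, reversed for \<open>a > 1\<close>, is an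
  equality at \<open>t = x / y\<close>. Hence the Hellinger integral of order \<open>a\<close> is the infimum (\<open>a < 1\<close>) or
  supremum (\<open>a > 1\<close>) of \<open>J t = a \<integral>t\<^sup>a\<^sup>-\<^sup>1 dP + (1 - a) \<integral>t\<^sup>a dQ\<close> over measurable \<open>t\<close> bounded away from
  \<open>0\<close> and \<open>\<infinity>\<close>. For \<open>t\<close> measurable with respect to a sub-sigma-algebra, \<open>J t\<close> does not change when \<open>P\<close>
  and \<open>Q\<close> are restricted to it, so passing to a larger sigma-algebra only enlarges the set of
  competitors, which gives monotonicity. Every competitor for the limit sigma-algebra is an almost
  everywhere limit of uniformly bounded competitors for the members of the family, which gives
  convergence for simple orders. The orders \<open>1\<close> and \<open>\<infinity>\<close> follow by exchanging suprema, since the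
  divergence is nondecreasing in its order.
\<close>

section \<open>Pointwise Young inequalities and their near-equality cases\<close>

lemma young_powr_le:
  fixes a x y t :: real
  assumes "0 < a" "a < 1" "0 \<le> x" "0 \<le> y" "0 < t"
  shows "x powr a * y powr (1 - a) \<le> a * t powr (a - 1) * x + (1 - a) * t powr a * y"
proof (cases "x = 0 \<or> y = 0")
  case True
  then show ?thesis using assms by auto
next
  case False
  then have xy: "0 < x" "0 < y" using assms by auto
  \<comment> \<open>The geometric mean of \<open>t powr (a - 1) * x\<close> and
    \<open>t powr a * y\<close> with weights \<open>a\<close> and \<open>1 - a\<close> is free of
    \<open>t\<close>, because the exponents \<open>(a - 1) * a\<close> and
    \<open>a * (1 - a)\<close> cancel.\<close>
  have "(t powr (a - 1) * x) powr a * (t powr a * y) powr (1 - a)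
      = (t powr ((a - 1) * a) * t powr (a * (1 - a))) * (x powr a * y powr (1 - a))"
    using xy assms by (simp add: powr_mult powr_powr)
  also have "t powr ((a - 1) * a) * t powr (a * (1 - a)) = 1"
    using assms by (simp add: algebra_simps flip: powr_add)
  finally show ?thesis
    using Youngs_inequality_0[of a "1 - a" "t powr (a - 1) * x" "t powr a * y"] assms xy
    by simp
qed

text \<open>Weighted AM-GM with weights \<open>1 / a\<close> and \<open>1 - 1 / a\<close>, applied
  to the right-hand side and \<open>t powr a * y\<close>, then multiplied by \<open>a\<close> and
  rearranged. At \<open>y = 0\<close> the real quotient would be \<open>0\<close> and the bound
  would fail for \<open>0 < x\<close>, hence the strict hypothesis on \<open>y\<close>.\<close>

lemma young_powr_ge:
  fixes a x y t :: real
  assumes "1 < a" "0 \<le> x" "0 < y" "0 < t"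
  shows "a * t powr (a - 1) * x + (1 - a) * t powr a * y \<le> x powr a / y powr (a - 1)"
proof (cases "x = 0")
  case True
  then show ?thesis using assms by (simp add: mult_nonpos_nonneg)
next
  case False
  then have x: "0 < x" using assms by auto
  define z where "z = x powr a / y powr (a - 1)"
  have z: "0 < z" using x assms by (simp add: z_def)
  define c where "c = 1 - 1 / a"
  have ac: "a * c = a - 1" "(a - 1) * (1 / a) = c" using assms by (simp_all add: c_def field_simps)
  have "z powr (1 / a) = x / y powr c"
    using x assms ac(2) by (simp add: z_def powr_divide powr_powr)
  moreover have "(t powr a * y) powr c = t powr (a - 1) * y powr c"
    using assms by (simp add: powr_mult powr_powr ac)
  ultimately have "z powr (1 / a) * (t powr a * y) powr (1 - 1 / a) = x * t powr (a - 1)"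
    using assms by (simp flip: c_def)
  then have "x * t powr (a - 1) \<le> 1 / a * z + (1 - 1 / a) * (t powr a * y)"
    using Youngs_inequality_0[of "1/a" "1 - 1/a" z "t powr a * y"] assms z by simp
  then have "a * (x * t powr (a - 1)) \<le> a * (1 / a * z + (1 - 1 / a) * (t powr a * y))"
    using assms by (intro mult_left_mono) auto
  also have "\<dots> = z + (a - 1) * (t powr a * y)"
    using assms by (simp add: field_simps)
  finally show ?thesis unfolding z_def by (simp add: algebra_simps)
qed

text \<open>
  The bounded approximation of the ratio \<open>t = x / y\<close> at which equality holds in
  \<open>young_powr_le\<close> and \<open>young_powr_ge\<close>, with value \<open>K\<close> when \<open>y = 0\<close>.
\<close>

definition clip_ratio :: "real \<Rightarrow> real \<Rightarrow> real \<Rightarrow> real" where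
  "clip_ratio K x y = (if K * y \<le> x then K else max (1 / K) (x / y))"

lemma clip_ratio_bounds:
  assumes "1 \<le> K" "0 \<le> x" "0 \<le> y"
  shows "1 / K \<le> clip_ratio K x y" "clip_ratio K x y \<le> K" "0 < clip_ratio K x y"
proof -
  have "1 / K \<le> K" using assms by (simp add: divide_le_eq mult_ge1_I)
  moreover have "x / y \<le> K" if "\<not> K * y \<le> x"
    using that assms by (cases "y = 0") (auto simp: divide_le_eq)
  ultimately show *: "1 / K \<le> clip_ratio K x y" "clip_ratio K x y \<le> K"
    by (auto simp: clip_ratio_def)
  show "0 < clip_ratio K x y" using *(1) assms by (smt (verit) divide_pos_pos)
qed

text \<open>The unclipped ratio gives equality. Clipping at \<open>K\<close> means
  \<open>K * y \<le> x\<close>, so the left side is at most \<open>K powr (a - 1) * x\<close>;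
  clipping at \<open>1 / K\<close> means \<open>x * K \<le> y\<close> and leaves at most
  \<open>K powr - a * y\<close>. Both error coefficients vanish as \<open>K\<close> grows.\<close>

lemma clip_ratio_young_le:
  assumes a: "0 < a" "a < 1" and K: "1 \<le> K" and xy: "0 \<le> x" "0 \<le> y"
  defines "t \<equiv> clip_ratio K x y"
  shows "a * t powr (a - 1) * x + (1 - a) * t powr a * y
    \<le> x powr a * y powr (1 - a) + (K powr (a - 1) * x + K powr - a * y)"
proof -
  consider "K * y \<le> x" | "\<not> K * y \<le> x" "x / y \<le> 1 / K" | "\<not> K * y \<le> x" "1 / K < x / y" by linarith
  then show ?thesis
  proof cases
    case 1
    have "K powr a * y = K powr (a - 1) * (K * y)"
      using K by (simp add: powr_diff)
    also have "\<dots> \<le> K powr (a - 1) * x" using 1 by (intro mult_left_mono) auto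
    finally have "(1 - a) * (K powr a * y) \<le> (1 - a) * (K powr (a - 1) * x)"
      using a by (intro mult_left_mono) auto
    then have "a * K powr (a - 1) * x + (1 - a) * K powr a * y \<le> K powr (a - 1) * x"
      by (simp add: algebra_simps)
    moreover have t: "t = K" using 1 by (simp add: t_def clip_ratio_def)
    moreover have "0 \<le> x powr a * y powr (1 - a)" "0 \<le> K powr - a * y" using xy by auto
    ultimately show ?thesis unfolding t by linarith
  next
    case 2
    have y: "0 < y" using 2 xy by (cases "y = 0") auto
    have t: "t = 1 / K" using 2 by (simp add: t_def clip_ratio_def)
    have tp: "t powr b = K powr - b" for b using K by (simp add: t powr_divide powr_minus_divide)
    have "x * K \<le> y" using 2 y K by (simp add: field_simps)
    have "K powr (1 - a) * x = K powr - a * (x * K)"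
      using K by (simp add: powr_diff powr_minus field_simps)
    also have "\<dots> \<le> K powr - a * y" using \<open>x * K \<le> y\<close> by (intro mult_left_mono) auto
    finally have "a * (K powr (1 - a) * x) \<le> a * (K powr - a * y)"
      using a by (intro mult_left_mono) auto
    then have "a * K powr (1 - a) * x + (1 - a) * K powr - a * y \<le> K powr - a * y"
      by (simp add: algebra_simps)
    moreover have "0 \<le> x powr a * y powr (1 - a)" "0 \<le> K powr (a - 1) * x" using xy by auto
    moreover have tp': "t powr (a - 1) = K powr (1 - a)" "t powr a = K powr - a" by (simp_all add: tp)
    ultimately show ?thesis unfolding tp' by linarith
  next
    case 3
    then have y: "0 < y" using xy K by (cases "y = 0") (auto simp: field_simps)
    have "0 < 1 / K" using K by simp
    then have x: "0 < x" using 3 y xy by (cases "x = 0") auto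
    have t: "t = x / y" using 3 by (simp add: t_def clip_ratio_def)
    have 1: "t powr (a - 1) * x = x powr a * y powr (1 - a)"
      using x y by (simp add: t powr_divide powr_diff field_simps)
    have 2: "t powr a * y = x powr a * y powr (1 - a)"
      using x y by (simp add: t powr_divide powr_diff field_simps)
    have "a * t powr (a - 1) * x + (1 - a) * t powr a * y = x powr a * y powr (1 - a)"
      unfolding mult.assoc 1 2 by (simp add: algebra_simps)
    moreover have "0 \<le> K powr (a - 1) * x" "0 \<le> K powr - a * y" using xy by auto
    ultimately show ?thesis by linarith
  qed
qed

text \<open>For \<open>1 < a\<close> this is \<open>x powr a / y powr (a - 1)\<close>, written as
  \<open>x * (x / y) powr (a - 1)\<close> with the ratio cut off from above at \<open>K\<close>. It
  stays finite at \<open>y = 0\<close>, and unlike \<open>clip_ratio\<close> it has no lower cutoff,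
  so it increases with \<open>K\<close>.\<close>

definition trunc_integrand :: "real \<Rightarrow> real \<Rightarrow> real \<Rightarrow> real \<Rightarrow> real" where
  "trunc_integrand a K x y = x * (if K * y \<le> x then K else x / y) powr (a - 1)"

text \<open>The upper cutoff costs nothing: \<open>K * y \<le> x\<close> lets the first term
  outweigh the negative one, leaving at least \<open>K powr (a - 1) * x\<close>. At the lower cutoff
  the negative term is absorbed by \<open>a * K powr - a * y\<close>, and the remaining
  \<open>K powr - a * y\<close> is at least the truncated integrand.\<close>

lemma clip_ratio_young_ge:
  assumes a: "1 < a" and K: "1 \<le> K" and xy: "0 \<le> x" "0 \<le> y"
  defines "t \<equiv> clip_ratio K x y"
  shows "trunc_integrand a K x y
    \<le> a * t powr (a - 1) * x + (1 - a) * t powr a * y + a * K powr - a * y"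
proof -
  consider "K * y \<le> x" | "\<not> K * y \<le> x" "x / y \<le> 1 / K" | "\<not> K * y \<le> x" "1 / K < x / y" by linarith
  then show ?thesis
  proof cases
    case 1
    have "K powr a * y = K powr (a - 1) * (K * y)"
      using K by (simp add: powr_diff)
    also have "\<dots> \<le> K powr (a - 1) * x" using 1 by (intro mult_left_mono) auto
    finally have "(a - 1) * (K powr a * y) \<le> (a - 1) * (K powr (a - 1) * x)"
      using a by (intro mult_left_mono) auto
    then have "K powr (a - 1) * x \<le> a * K powr (a - 1) * x + (1 - a) * K powr a * y"
      by (simp add: algebra_simps)
    moreover have "t = K" using 1 by (simp add: t_def clip_ratio_def)
    moreover have "0 \<le> a * K powr - a * y" using xy a by auto
    ultimately show ?thesis using 1 by (simp add: trunc_integrand_def mult.commute)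
  next
    case 2
    have y: "0 < y" using 2 xy by (cases "y = 0") auto
    have t: "t = 1 / K" using 2 by (simp add: t_def clip_ratio_def)
    have tp: "t powr b = K powr - b" for b using K by (simp add: t powr_divide powr_minus_divide)
    have "trunc_integrand a K x y = x * (x / y) powr (a - 1)"
      using 2 by (simp add: trunc_integrand_def)
    also have "\<dots> = y * (x / y) powr a"
      using y xy by (cases "x = 0") (auto simp: powr_diff)
    also have "\<dots> \<le> y * (1 / K) powr a"
      using 2 y a xy by (intro mult_left_mono powr_mono2) auto
    finally have "trunc_integrand a K x y \<le> K powr - a * y"
      using tp[of a] by (simp add: t mult.commute)
    moreover have "0 \<le> a * K powr (1 - a) * x" using a xy by simp
    ultimately show ?thesis by (simp add: tp algebra_simps)
  next
    case 3
    then have y: "0 < y" using xy K by (cases "y = 0") (auto simp: field_simps)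
    have "0 < 1 / K" using K by simp
    then have x: "0 < x" using 3 y xy by (cases "x = 0") auto
    have t: "t = x / y" using 3 by (simp add: t_def clip_ratio_def)
    have 1: "t powr (a - 1) * x = x * (x / y) powr (a - 1)" by (simp add: t)
    have 2: "t powr a * y = x * (x / y) powr (a - 1)"
      using x y by (simp add: t powr_diff)
    have "a * t powr (a - 1) * x + (1 - a) * t powr a * y = trunc_integrand a K x y"
      unfolding mult.assoc 1 2 using 3 by (simp add: algebra_simps trunc_integrand_def)
    moreover have "0 \<le> a * K powr - a * y" using xy a by auto
    ultimately show ?thesis by linarith
  qed
qed

lemma incseq_trunc_integrand:
  assumes "1 < a" "0 \<le> x" "0 \<le> y"
  shows "incseq (\<lambda>n. trunc_integrand a (real (Suc n)) x y)"
proof (rule incseq_SucI)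
  fix n
  have "(if real (Suc n) * y \<le> x then real (Suc n) else x / y) powr (a - 1)
      \<le> (if real (Suc (Suc n)) * y \<le> x then real (Suc (Suc n)) else x / y) powr (a - 1)"
  proof (rule powr_mono2)
    show "(if real (Suc n) * y \<le> x then real (Suc n) else x / y)
      \<le> (if real (Suc (Suc n)) * y \<le> x then real (Suc (Suc n)) else x / y)"
    proof (cases "y = 0")
      case False
      then have y: "0 < y" using assms by simp
      have "real (Suc n) * y \<le> real (Suc (Suc n)) * y" using y by (intro mult_right_mono) auto
      moreover have "x / y \<le> real (Suc (Suc n))" if "\<not> real (Suc (Suc n)) * y \<le> x"
        using that y by (simp add: divide_le_eq)
      moreover have "real (Suc n) \<le> x / y" if "real (Suc n) * y \<le> x"
        using that y by (simp add: le_divide_eq)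
      ultimately show ?thesis by (auto simp del: of_nat_Suc)
    qed (use assms in auto)
  qed (use assms in auto)
  then show "trunc_integrand a (real (Suc n)) x y \<le> trunc_integrand a (real (Suc (Suc n))) x y"
    using assms unfolding trunc_integrand_def by (intro mult_left_mono) auto
qed

lemma trunc_integrand_nonneg: "0 \<le> x \<Longrightarrow> 0 \<le> trunc_integrand a K x y"
  by (simp add: trunc_integrand_def)

lemma trunc_integrand_tendsto:
  assumes a: "1 < a" and xy: "0 \<le> x" "0 \<le> y"
  shows "(\<lambda>n. ennreal (trunc_integrand a (real (Suc n)) x y)) \<longlonglongrightarrow> renyi_integrand a x y"
proof -
  consider "x = 0" | "0 < x" "0 < y" | "0 < x" "y = 0" using xy by linarith
  then show ?thesis
  proof cases
    case 1
    then show ?thesis using a by (simp add: trunc_integrand_def renyi_integrand_def)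
  next
    case 2
    have "eventually (\<lambda>n. x / y < real (Suc n)) sequentially"
      by (intro eventually_compose_filterlim[OF _ filterlim_Suc]) real_asymp
    then have "eventually (\<lambda>n. ennreal (trunc_integrand a (real (Suc n)) x y) = renyi_integrand a x y) sequentially"
    proof eventually_elim
      case (elim n)
      then have "\<not> real (Suc n) * y \<le> x" using 2 by (simp add: divide_less_eq)
      then have "trunc_integrand a (real (Suc n)) x y = x * (x / y) powr (a - 1)"
        by (simp add: trunc_integrand_def)
      also have "\<dots> = x powr a / y powr (a - 1)"
        using 2 by (simp add: powr_divide powr_diff)
      finally show ?case using 2 a by (simp add: renyi_integrand_def divide_ennreal)
    qed
    then show ?thesis by (rule tendsto_eventually)
  next
    case 3
    \<comment> \<open>With \<open>y = 0\<close> the cutoff is always active, so the values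
      \<open>x * real (Suc n) powr (a - 1)\<close> diverge, matching the convention
      \<open>x / 0 = \<infinity>\<close>.\<close>
    have "filterlim (\<lambda>n. trunc_integrand a (real (Suc n)) x y) at_top sequentially"
      using 3 a unfolding trunc_integrand_def by simp real_asymp
    then have "(\<lambda>n. ennreal (trunc_integrand a (real (Suc n)) x y)) \<longlonglongrightarrow> \<top>"
      by (rule ennreal_tendsto_top_eq_at_top[THEN iffD2])
    moreover have "renyi_integrand a x y = \<top>"
      using 3 a by (simp add: renyi_integrand_def ennreal_divide_eq_top_iff)
    ultimately show ?thesis by simp
  qed
qed

section \<open>Bounded competitors and the Young functional\<close>

text \<open>The bound away from 0 keeps negative powers bounded too, so every real power of a member
  is integrable under any finite measure on the same sigma-algebra.\<close>

definition test_fns :: "'a measure \<Rightarrow> ('a \<Rightarrow> real) set" where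
  "test_fns M = {t \<in> borel_measurable M. \<exists>K>0. \<forall>x\<in>space M. 1 / K \<le> t x \<and> t x \<le> K}"

lemma filterlim_real_Suc: "filterlim (\<lambda>n. real (Suc n)) at_top sequentially"
  by real_asymp

lemma test_fnsE:
  assumes "t \<in> test_fns M"
  obtains K where "0 < K" "\<And>x. x \<in> space M \<Longrightarrow> 1 / K \<le> t x" "\<And>x. x \<in> space M \<Longrightarrow> t x \<le> K"
    "t \<in> borel_measurable M"
  using assms unfolding test_fns_def by blast

lemma test_fns_pos: "t \<in> test_fns M \<Longrightarrow> x \<in> space M \<Longrightarrow> 0 < t x"
  by (elim test_fnsE) (smt (verit) zero_less_divide_1_iff)

lemma powr_le_of_bounds:
  fixes t K b :: real
  assumes "0 < K" "1 / K \<le> t" "t \<le> K"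
  shows "t powr b \<le> max (K powr b) ((1 / K) powr b)"
proof -
  have "0 < 1 / K" using assms by simp
  then have "0 < t" using assms by linarith
  show ?thesis
  proof (cases "0 \<le> b")
    case True
    then show ?thesis using assms \<open>0 < t\<close> by (intro max.coboundedI1 powr_mono2) auto
  next
    case False
    then show ?thesis using assms \<open>0 < t\<close> by (intro max.coboundedI2 powr_mono2') auto
  qed
qed

text \<open>\<open>N\<close> is kept apart from \<open>M\<close> so that competitors for
  \<open>P\<close> can be integrated against \<open>Q\<close>.\<close>

lemma (in finite_measure) integrable_test_fn_powr:
  assumes "t \<in> test_fns N" "sets N = sets M"
  shows "integrable M (\<lambda>x. t x powr b)"
  using assms(1)
proof (rule test_fnsE)
  fix K assume K: "0 < K" "\<And>x. x \<in> space N \<Longrightarrow> 1 / K \<le> t x" "\<And>x. x \<in> space N \<Longrightarrow> t x \<le> K"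
    "t \<in> borel_measurable N"
  have [measurable]: "t \<in> borel_measurable M" using K(4) assms(2) measurable_cong_sets by blast
  have sp: "space N = space M" using assms(2) by (rule sets_eq_imp_space_eq)
  show ?thesis
    by (rule integrable_const_bound[where B = "max (K powr b) ((1 / K) powr b)"])
      (use K sp in \<open>auto intro!: powr_le_of_bounds AE_I2 simp del: max.bounded_iff le_max_iff_disj\<close>)
qed

text \<open>Integrals against \<open>P\<close> and \<open>Q\<close> are used instead of densities:
  densities change under restriction to a sub-sigma-algebra, whereas these integrals do not as long
  as \<open>t\<close> is measurable there.\<close>

definition young_functional :: "real \<Rightarrow> 'a measure \<Rightarrow> 'a measure \<Rightarrow> ('a \<Rightarrow> real) \<Rightarrow> real" where
  "young_functional a P Q t = a * (\<integral>x. t x powr (a - 1) \<partial>P) + (1 - a) * (\<integral>x. t x powr a \<partial>Q)"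

definition hellinger_integral :: "real \<Rightarrow> 'a measure \<Rightarrow> 'a measure \<Rightarrow> ennreal" where
  "hellinger_integral a P Q =
     (let \<mu> = sum_measure P Q in
      \<integral>\<^sup>+x. renyi_integrand a (enn2real (RN_deriv \<mu> P x)) (enn2real (RN_deriv \<mu> Q x)) \<partial>\<mu>)"

lemma renyi_simple_hellinger:
  "renyi_simple a P Q = ereal (1 / (a - 1)) * ln_ennreal (hellinger_integral a P Q)"
  by (simp add: renyi_simple_def renyi_of_densities_def hellinger_integral_def Let_def)

section \<open>Variational formulas for the Hellinger integral\<close>

locale prob_pair = P: prob_space P + Q: prob_space Q for P Q :: "'a measure" +
  assumes sets_Q: "sets Q = sets P"
begin

definition \<mu> :: "'a measure" where "\<mu> = sum_measure P Q"
definition p :: "'a \<Rightarrow> real" where "p x = enn2real (RN_deriv \<mu> P x)"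
definition q :: "'a \<Rightarrow> real" where "q x = enn2real (RN_deriv \<mu> Q x)"

lemma sets_\<mu> [simp, measurable_cong]: "sets \<mu> = sets P"
  by (simp add: \<mu>_def)

lemma space_Q: "space Q = space P"
  using sets_Q by (rule sets_eq_imp_space_eq)

lemma space_\<mu> [simp]: "space \<mu> = space P"
  by (simp add: \<mu>_def)

lemma finite_measure_\<mu>: "finite_measure \<mu>"
proof (rule finite_measureI)
  have "emeasure Q (space P) = 1" using Q.emeasure_space_1 by (simp add: space_Q)
  then show "emeasure \<mu> (space \<mu>) \<noteq> \<infinity>"
    by (simp add: \<mu>_def emeasure_sum_measure[OF sets_Q] P.emeasure_space_1)
qed

sublocale \<mu>: finite_measure \<mu> by (rule finite_measure_\<mu>)

lemma p_measurable [measurable]: "p \<in> borel_measurable \<mu>" unfolding p_def by measurable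
lemma q_measurable [measurable]: "q \<in> borel_measurable \<mu>" unfolding q_def by measurable
lemma p_nonneg [simp]: "0 \<le> p x" and q_nonneg [simp]: "0 \<le> q x"
  by (simp_all add: p_def q_def)

text \<open>The derivative of a finite \<open>R\<close> is finite almost everywhere, so passing to
  real values changes it only on a null set.\<close>

lemma density_enn2real_RN_deriv:
  assumes "finite_measure R" "absolutely_continuous \<mu> R" "sets R = sets \<mu>"
  shows "density \<mu> (\<lambda>x. ennreal (enn2real (RN_deriv \<mu> R x))) = R"
proof -
  interpret R: finite_measure R by fact
  have "AE x in \<mu>. RN_deriv \<mu> R x \<noteq> \<infinity>"
    using assms by (intro \<mu>.RN_deriv_finite R.sigma_finite_measure_axioms)
  then have "density \<mu> (\<lambda>x. ennreal (enn2real (RN_deriv \<mu> R x))) = density \<mu> (RN_deriv \<mu> R)"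
    by (intro density_cong) (auto elim!: eventually_mono simp: less_top)
  then show ?thesis using assms \<mu>.density_RN_deriv by metis
qed

lemma density_p: "P = density \<mu> (\<lambda>x. ennreal (p x))"
  unfolding p_def
  by (subst density_enn2real_RN_deriv[OF P.finite_measure_axioms])
    (auto simp: absolutely_continuous_def null_sets_def, simp add: \<mu>_def emeasure_sum_measure[OF sets_Q])

lemma density_q: "Q = density \<mu> (\<lambda>x. ennreal (q x))"
  unfolding q_def
  by (subst density_enn2real_RN_deriv[OF Q.finite_measure_axioms])
    (auto simp: absolutely_continuous_def null_sets_def sets_Q, simp add: \<mu>_def emeasure_sum_measure[OF sets_Q])

lemma hellinger_integral_eq: "hellinger_integral a P Q = (\<integral>\<^sup>+x. renyi_integrand a (p x) (q x) \<partial>\<mu>)"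
  by (simp add: hellinger_integral_def Let_def p_def q_def flip: \<mu>_def)

lemma nn_integral_p: "(\<integral>\<^sup>+x. ennreal (p x) \<partial>\<mu>) = 1"
proof -
  have "emeasure (density \<mu> (\<lambda>x. ennreal (p x))) (space \<mu>) = 1"
    using P.emeasure_space_1 by (simp flip: density_p)
  then have "(\<integral>\<^sup>+x. ennreal (p x) * indicator (space \<mu>) x \<partial>\<mu>) = 1"
    by (subst (asm) emeasure_density) auto
  moreover have "(\<integral>\<^sup>+x. ennreal (p x) * indicator (space \<mu>) x \<partial>\<mu>) = (\<integral>\<^sup>+x. ennreal (p x) \<partial>\<mu>)"
    by (intro nn_integral_cong) simp
  ultimately show ?thesis by simp
qed

lemma nn_integral_q: "(\<integral>\<^sup>+x. ennreal (q x) \<partial>\<mu>) = 1"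
proof -
  have "emeasure (density \<mu> (\<lambda>x. ennreal (q x))) (space \<mu>) = 1"
    using Q.emeasure_space_1 by (simp flip: density_q add: space_Q)
  then have "(\<integral>\<^sup>+x. ennreal (q x) * indicator (space \<mu>) x \<partial>\<mu>) = 1"
    by (subst (asm) emeasure_density) auto
  moreover have "(\<integral>\<^sup>+x. ennreal (q x) * indicator (space \<mu>) x \<partial>\<mu>) = (\<integral>\<^sup>+x. ennreal (q x) \<partial>\<mu>)"
    by (intro nn_integral_cong) simp
  ultimately show ?thesis by simp
qed

lemma integrable_q: "integrable \<mu> q" and integral_q: "(\<integral>x. q x \<partial>\<mu>) = 1"
  using nn_integral_q by (auto intro!: integrableI_nonneg simp: integral_eq_nn_integral)

text \<open>Both integrals are moved to the common dominating measure, where the pointwise Young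
  inequalities can be integrated.\<close>

lemma young_functional_eq:
  assumes t: "t \<in> test_fns P"
  shows "integrable \<mu> (\<lambda>x. a * t x powr (a - 1) * p x + (1 - a) * t x powr a * q x)"
    and "young_functional a P Q t
      = (\<integral>x. a * t x powr (a - 1) * p x + (1 - a) * t x powr a * q x \<partial>\<mu>)"
proof -
  let ?f = "\<lambda>x. a * t x powr (a - 1) * p x + (1 - a) * t x powr a * q x"
  have [measurable]: "t \<in> borel_measurable \<mu>"
    using t by (auto simp: test_fns_def)
  have "integrable P (\<lambda>x. t x powr (a - 1))" "integrable Q (\<lambda>x. t x powr a)"
    using t sets_Q by (auto intro!: P.integrable_test_fn_powr Q.integrable_test_fn_powr)
  then have 1: "integrable \<mu> (\<lambda>x. p x * t x powr (a - 1))" "integrable \<mu> (\<lambda>x. q x * t x powr a)"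
    using integrable_density[of "\<lambda>x. t x powr (a - 1)" \<mu> p] integrable_density[of "\<lambda>x. t x powr a" \<mu> q]
    by (simp_all flip: density_p density_q)
  have 2: "(\<integral>x. t x powr (a - 1) \<partial>P) = (\<integral>x. p x * t x powr (a - 1) \<partial>\<mu>)"
    using integral_density[of "\<lambda>x. t x powr (a - 1)" \<mu> p] by (simp flip: density_p)
  have 3: "(\<integral>x. t x powr a \<partial>Q) = (\<integral>x. q x * t x powr a \<partial>\<mu>)"
    using integral_density[of "\<lambda>x. t x powr a" \<mu> q] by (simp flip: density_q)
  have f: "?f = (\<lambda>x. a * (p x * t x powr (a - 1)) + (1 - a) * (q x * t x powr a))"
    by (auto simp: algebra_simps)
  show "integrable \<mu> ?f" unfolding f using 1 by (intro Bochner_Integration.integrable_add integrable_mult_right)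
  show "young_functional a P Q t = (\<integral>x. ?f x \<partial>\<mu>)" unfolding f young_functional_def 2 3
    using 1 by simp
qed

lemma clip_ratio_test_fn:
  assumes "1 \<le> K"
  shows "(\<lambda>x. clip_ratio K (p x) (q x)) \<in> test_fns P"
proof -
  have "(\<lambda>x. clip_ratio K (p x) (q x)) \<in> borel_measurable \<mu>"
    unfolding clip_ratio_def by measurable
  then have "(\<lambda>x. clip_ratio K (p x) (q x)) \<in> borel_measurable P"
    using sets_\<mu> measurable_cong_sets by blast
  then show ?thesis unfolding test_fns_def
    using assms clip_ratio_bounds[OF assms] by (auto intro!: exI[of _ K])
qed

lemma hellinger_integral_le_young:
  assumes a: "0 < a" "a < 1" and t: "t \<in> test_fns P"
  shows "hellinger_integral a P Q \<le> ennreal (young_functional a P Q t)"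
proof -
  let ?f = "\<lambda>x. a * t x powr (a - 1) * p x + (1 - a) * t x powr a * q x"
  have "hellinger_integral a P Q \<le> (\<integral>\<^sup>+x. ennreal (?f x) \<partial>\<mu>)"
    unfolding hellinger_integral_eq
    using a test_fns_pos[OF t]
    by (intro nn_integral_mono) (auto simp: renyi_integrand_def simp del: ennreal_plus intro!: ennreal_leI young_powr_le)
  also have "\<dots> = ennreal (\<integral>x. ?f x \<partial>\<mu>)"
    using a by (intro nn_integral_eq_integral young_functional_eq t AE_I2) auto
  finally show ?thesis by (simp add: young_functional_eq(2)[OF t])
qed

lemma hellinger_integral_ge_young:
  assumes a: "1 < a" and t: "t \<in> test_fns P"
  shows "ennreal (young_functional a P Q t) \<le> hellinger_integral a P Q"
proof -
  let ?f = "\<lambda>x. a * t x powr (a - 1) * p x + (1 - a) * t x powr a * q x"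
  have int: "integrable \<mu> ?f" by (rule young_functional_eq[OF t])
  \<comment> \<open>For \<open>1 < a\<close> the Young expression can be negative, so its positive
    part is compared with the nonnegative integrand.\<close>
  have "young_functional a P Q t \<le> (\<integral>x. max 0 (?f x) \<partial>\<mu>)"
    unfolding young_functional_eq(2)[OF t] using int by (intro integral_mono integrable_max) auto
  then have "ennreal (young_functional a P Q t) \<le> (\<integral>\<^sup>+x. ennreal (max 0 (?f x)) \<partial>\<mu>)"
    using int by (subst nn_integral_eq_integral) (auto intro!: ennreal_leI integrable_max)
  also have "\<dots> \<le> hellinger_integral a P Q"
    unfolding hellinger_integral_eq
  proof (intro nn_integral_mono)
    fix x assume x: "x \<in> space \<mu>"
    have tx: "0 < t x" using test_fns_pos[OF t] x by simp
    show "ennreal (max 0 (?f x)) \<le> renyi_integrand a (p x) (q x)"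
    proof (cases "q x = 0")
      case False
      then have "0 < q x" using q_nonneg[of x] by linarith
      then show ?thesis
        using young_powr_ge[OF a p_nonneg \<open>0 < q x\<close> tx, of x] a
        by (auto simp: renyi_integrand_def divide_ennreal intro!: ennreal_leI)
    next
      case True
      \<comment> \<open>Here \<open>young_powr_ge\<close> does not apply: the integrand is infinite
        if \<open>0 < p x\<close>, and otherwise the Young expression is \<open>0\<close>.\<close>
      then show ?thesis using a
        by (cases "p x = 0") (auto simp: renyi_integrand_def ennreal_divide_eq_top_iff
            divide_ennreal_def ennreal_mult_eq_top_iff ennreal_mult_top)
    qed
  qed
  finally show ?thesis .
qed

text \<open>The clipped ratio of the densities with \<open>K = real (Suc n)\<close> is a competitor
  whose value exceeds the Hellinger integral by at most \<open>K powr (a - 1) + K powr - a\<close>,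
  since \<open>p\<close> and \<open>q\<close> integrate to 1. Both exponents are negative, so the
  excess vanishes.\<close>

lemma hellinger_integral_eq_INF:
  assumes a: "0 < a" "a < 1"
  shows "hellinger_integral a P Q = (INF t\<in>test_fns P. ennreal (young_functional a P Q t))"
proof (rule antisym)
  show "hellinger_integral a P Q \<le> (INF t\<in>test_fns P. ennreal (young_functional a P Q t))"
    using a by (intro INF_greatest hellinger_integral_le_young)
  have *: "(INF t\<in>test_fns P. ennreal (young_functional a P Q t))
      \<le> hellinger_integral a P Q + ennreal (real (Suc n) powr (a - 1) + real (Suc n) powr - a)" for n
  proof -
    define K where "K = real (Suc n)"
    have K: "1 \<le> K" by (simp add: K_def)
    define t where "t x = clip_ratio K (p x) (q x)" for x
    have t: "t \<in> test_fns P" unfolding t_def[abs_def] using K by (rule clip_ratio_test_fn)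
    have "(INF t\<in>test_fns P. ennreal (young_functional a P Q t)) \<le> ennreal (young_functional a P Q t)"
      using t by (rule INF_lower)
    also have "\<dots> = (\<integral>\<^sup>+x. ennreal (a * t x powr (a - 1) * p x + (1 - a) * t x powr a * q x) \<partial>\<mu>)"
      unfolding young_functional_eq(2)[OF t]
      using a by (intro nn_integral_eq_integral[symmetric] young_functional_eq t AE_I2) auto
    also have "\<dots> \<le> (\<integral>\<^sup>+x. renyi_integrand a (p x) (q x)
        + (ennreal (K powr (a - 1)) * ennreal (p x) + ennreal (K powr - a) * ennreal (q x)) \<partial>\<mu>)"
      using a clip_ratio_young_le[OF a K p_nonneg q_nonneg]
      by (intro nn_integral_mono)
        (auto simp: renyi_integrand_def t_def intro!: ennreal_leI simp flip: ennreal_plus ennreal_mult)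
    also have "\<dots> = hellinger_integral a P Q + (ennreal (K powr (a - 1)) + ennreal (K powr - a))"
      by (simp add: nn_integral_add nn_integral_cmult nn_integral_p nn_integral_q hellinger_integral_eq)
    finally show ?thesis by (simp add: K_def ennreal_plus)
  qed
  have "(\<lambda>n. real (Suc n) powr (a - 1) + real (Suc n) powr - a) \<longlonglongrightarrow> 0"
    using a by (intro tendsto_add_zero tendsto_neg_powr filterlim_real_Suc) auto
  then have "(\<lambda>n. hellinger_integral a P Q + ennreal (real (Suc n) powr (a - 1) + real (Suc n) powr - a))
     \<longlonglongrightarrow> hellinger_integral a P Q + ennreal 0"
    by (intro tendsto_add tendsto_const tendsto_ennrealI)
  then show "(INF t\<in>test_fns P. ennreal (young_functional a P Q t)) \<le> hellinger_integral a P Q"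
    using * by (intro LIMSEQ_le_const) auto
qed

text \<open>The Hellinger integral may be infinite, so competitors are compared with the truncated
  integrals \<open>?T n\<close>. Each of these is below the supremum up to a vanishing error, and
  monotone convergence carries the bound to the limit.\<close>

lemma hellinger_integral_eq_SUP:
  assumes a: "1 < a"
  shows "hellinger_integral a P Q = (SUP t\<in>test_fns P. ennreal (young_functional a P Q t))"
proof (rule antisym)
  show "(SUP t\<in>test_fns P. ennreal (young_functional a P Q t)) \<le> hellinger_integral a P Q"
    using a by (intro SUP_least hellinger_integral_ge_young)
  let ?S = "SUP t\<in>test_fns P. ennreal (young_functional a P Q t)"
  let ?T = "\<lambda>n. \<integral>\<^sup>+x. ennreal (trunc_integrand a (real (Suc n)) (p x) (q x)) \<partial>\<mu>"
  have [measurable]: "(\<lambda>x. trunc_integrand a K (p x) (q x)) \<in> borel_measurable \<mu>" for K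
    unfolding trunc_integrand_def by measurable
  have *: "?T n \<le> ?S + ennreal (a * real (Suc n) powr - a)" for n
  proof -
    define K where "K = real (Suc n)"
    have K: "1 \<le> K" by (simp add: K_def)
    define t where "t x = clip_ratio K (p x) (q x)" for x
    have t: "t \<in> test_fns P" unfolding t_def[abs_def] using K by (rule clip_ratio_test_fn)
    let ?f = "\<lambda>x. a * t x powr (a - 1) * p x + (1 - a) * t x powr a * q x"
    let ?g = "\<lambda>x. trunc_integrand a K (p x) (q x)"
    let ?h = "\<lambda>x. a * K powr - a * q x"
    have h: "integrable \<mu> ?h" "(\<integral>x. ?h x \<partial>\<mu>) = a * K powr - a"
      using integrable_q integral_q by auto
    have f: "integrable \<mu> ?f" by (rule young_functional_eq[OF t])
    have le: "?g x \<le> ?f x + ?h x" for x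
      using clip_ratio_young_ge[OF a K p_nonneg q_nonneg, of x x] by (simp add: t_def)
    have "(\<integral>\<^sup>+x. ennreal (?g x) \<partial>\<mu>) \<le> (\<integral>\<^sup>+x. ennreal (?f x + ?h x) \<partial>\<mu>)"
      using le by (intro nn_integral_mono ennreal_leI) auto
    also have "\<dots> = ennreal (\<integral>x. ?f x + ?h x \<partial>\<mu>)"
    proof (intro nn_integral_eq_integral Bochner_Integration.integrable_add[OF f h(1)] AE_I2)
      show "0 \<le> ?f x + ?h x" for x
        using le[of x] trunc_integrand_nonneg[OF p_nonneg] by (meson order_trans)
    qed
    also have "(\<integral>x. ?f x + ?h x \<partial>\<mu>) = young_functional a P Q t + a * K powr - a"
      using f h by (simp add: young_functional_eq(2)[OF t])
    \<comment> \<open>Subadditivity survives a negative first summand, which \<open>ennreal\<close>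
      sends to \<open>0\<close>.\<close>
    also have "ennreal \<dots> \<le> ennreal (young_functional a P Q t) + ennreal (a * K powr - a)"
      using a by (cases "0 \<le> young_functional a P Q t") (auto simp: ennreal_neg intro!: ennreal_leI)
    also have "\<dots> \<le> ?S + ennreal (a * K powr - a)"
      using t by (intro add_right_mono SUP_upper)
    finally show ?thesis by (simp only: K_def)
  qed
  have "?T \<longlonglongrightarrow> hellinger_integral a P Q"
    unfolding hellinger_integral_eq
  proof (rule nn_integral_LIMSEQ)
    show "incseq (\<lambda>n x. ennreal (trunc_integrand a (real (Suc n)) (p x) (q x)))"
      using incseq_trunc_integrand[OF a p_nonneg q_nonneg]
      by (auto simp: incseq_def le_fun_def intro!: ennreal_leI simp del: of_nat_Suc)
  qed (use trunc_integrand_tendsto[OF a p_nonneg q_nonneg] in \<open>auto simp del: of_nat_Suc\<close>)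
  moreover have "(\<lambda>n. a * real (Suc n) powr - a) \<longlonglongrightarrow> 0"
    using a by (intro tendsto_mult_right_zero tendsto_neg_powr filterlim_real_Suc) auto
  then have "(\<lambda>n. ?S + ennreal (a * real (Suc n) powr - a)) \<longlonglongrightarrow> ?S + ennreal 0"
    by (intro tendsto_add tendsto_const tendsto_ennrealI)
  ultimately show "hellinger_integral a P Q \<le> ?S"
    using * by (intro LIMSEQ_le[where X = ?T]) auto
qed

end

section \<open>The extended logarithm and monotonicity of the divergence in its order\<close>

lemma range_ln_ennreal: "range ln_ennreal = UNIV"
proof -
  have "y \<in> range ln_ennreal" for y
  proof (cases y)
    case (real r)
    then have "y = ln_ennreal (ennreal (exp r))" by (simp add: ln_ennreal_def)
    then show ?thesis by blast
  next
    case PInf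
    then have "y = ln_ennreal \<top>" by (simp add: ln_ennreal_def)
    then show ?thesis by blast
  next
    case MInf
    then have "y = ln_ennreal 0" by (simp add: ln_ennreal_def)
    then show ?thesis by blast
  qed
  then show ?thesis by blast
qed

lemma ln_ennreal_mono:
  assumes "x \<le> y" shows "ln_ennreal x \<le> ln_ennreal y"
proof (cases "x = 0 \<or> y = \<infinity>")
  case False
  then obtain s where y: "y = ennreal s" "0 \<le> s" by (cases y) auto
  with assms False obtain r where x: "x = ennreal r" "0 \<le> r"
    by (cases x) (auto simp: top_unique)
  then have "0 < r" using False by (cases "r = 0") auto
  moreover have "r \<le> s" using assms x y by simp
  ultimately show ?thesis by (simp add: ln_ennreal_def x y)
qed (use assms in \<open>auto simp: ln_ennreal_def\<close>)

text \<open>A monotone surjection between linear orders has no jumps, which gives continuity at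
  \<open>0\<close> and \<open>\<infinity>\<close> as well.\<close>

lemma tendsto_ln_ennreal:
  assumes "(f \<longlongrightarrow> x) F" shows "((\<lambda>i. ln_ennreal (f i)) \<longlongrightarrow> ln_ennreal x) F"
proof -
  have "continuous_on UNIV ln_ennreal"
    by (rule continuous_onI_mono) (simp_all add: range_ln_ennreal ln_ennreal_mono)
  from continuous_on_tendsto_compose[OF this assms] show ?thesis by simp
qed

text \<open>
  With \<open>s\<close> chosen as the Hellinger integral of order \<open>c\<close>, this is the Hoelder bound by its \<open>\<gamma>\<close>-th power;
  keeping \<open>s\<close> free also covers the case where that integral vanishes.
\<close>

lemma (in prob_pair) hellinger_integral_le_young_order:
  assumes o: "0 < c" "c \<noteq> 1" and \<gamma>: "0 < \<gamma>" "\<gamma> < 1" and s: "0 < s"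
    and b: "b - 1 = \<gamma> * (c - 1)"
  shows "hellinger_integral b P Q
    \<le> ennreal (\<gamma> * s powr (\<gamma> - 1)) * hellinger_integral c P Q + ennreal ((1 - \<gamma>) * s powr \<gamma>)"
proof -
  have "hellinger_integral b P Q \<le> (\<integral>\<^sup>+x. ennreal (\<gamma> * s powr (\<gamma> - 1)) * renyi_integrand c (p x) (q x)
      + ennreal ((1 - \<gamma>) * s powr \<gamma>) * ennreal (p x) \<partial>\<mu>)"
    unfolding hellinger_integral_eq
  proof (intro nn_integral_mono)
    fix x
    show "renyi_integrand b (p x) (q x) \<le> ennreal (\<gamma> * s powr (\<gamma> - 1)) * renyi_integrand c (p x) (q x)
      + ennreal ((1 - \<gamma>) * s powr \<gamma>) * ennreal (p x)"
    proof (cases "p x = 0 \<or> q x = 0")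
      case False
      then have pq: "0 < p x" "0 < q x" using p_nonneg[of x] q_nonneg[of x] by linarith+
      have eq: "renyi_integrand a (p x) (q x) = ennreal (p x powr a * q x powr (1 - a))" for a
        using pq by (auto simp: renyi_integrand_def divide_ennreal powr_diff)
      \<comment> \<open>\<open>p x\<close> is the integrand of order 1 and \<open>b\<close> lies
        between 1 and \<open>c\<close>, so the integrand of order \<open>b\<close> is a weighted
        geometric mean of the other two.\<close>
      have "p x powr b * q x powr (1 - b)
          = (p x powr c * q x powr (1 - c)) powr \<gamma> * p x powr (1 - \<gamma>)"
      proof -
        have "b = c * \<gamma> + (1 - \<gamma>)" "1 - b = (1 - c) * \<gamma>"
          using b by (simp_all add: algebra_simps)
        then show ?thesis using pq by (simp add: powr_mult powr_powr powr_add)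
      qed
      also have "\<dots> \<le> \<gamma> * s powr (\<gamma> - 1) * (p x powr c * q x powr (1 - c)) + (1 - \<gamma>) * s powr \<gamma> * p x"
        using \<gamma> s by (intro young_powr_le) auto
      finally show ?thesis unfolding eq using \<gamma>
        by (simp add: ennreal_leI flip: ennreal_plus ennreal_mult)
    next
      case True
      \<comment> \<open>Since \<open>b\<close> and \<open>c\<close> lie on the same side of 1, at a
        zero of \<open>p\<close> or \<open>q\<close> the two integrands vanish together or are
        infinite together; a positive factor preserves the infinite value.\<close>
      have "0 < \<gamma> * s powr (\<gamma> - 1)" using \<gamma> s by simp
      moreover have "c < 1 \<longleftrightarrow> b < 1"
        using b \<gamma> by (smt (verit) mult_less_0_iff mult_pos_pos)
      moreover have "b \<noteq> 1" using b \<gamma> o by auto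
      ultimately show ?thesis using True o
        by (cases "p x = 0") (auto simp: renyi_integrand_def ennreal_mult_top ennreal_divide_eq_top_iff
            divide_ennreal_def ennreal_mult_eq_top_iff)
    qed
  qed
  also have "\<dots> = ennreal (\<gamma> * s powr (\<gamma> - 1)) * hellinger_integral c P Q + ennreal ((1 - \<gamma>) * s powr \<gamma>)"
    by (simp add: nn_integral_add nn_integral_cmult nn_integral_p hellinger_integral_eq)
  finally show ?thesis .
qed

text \<open>The Hoelder exponent \<gamma> is absorbed after taking logarithms, because
  \<open>\<bar>b - 1\<bar> = \<gamma> * \<bar>c - 1\<bar>\<close>. The absolute values treat orders
  below and above 1 together.\<close>

lemma (in prob_pair) renyi_simple_mono_aux:
  assumes o: "0 < c" "c \<noteq> 1" and \<gamma>: "0 < \<gamma>" "\<gamma> < 1"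
    and b: "b - 1 = \<gamma> * (c - 1)"
  shows "ereal (1 / \<bar>b - 1\<bar>) * ln_ennreal (hellinger_integral b P Q)
    \<le> ereal (1 / \<bar>c - 1\<bar>) * ln_ennreal (hellinger_integral c P Q)"
proof -
  have abs: "\<bar>b - 1\<bar> = \<gamma> * \<bar>c - 1\<bar>" "0 < \<bar>c - 1\<bar>" "0 < \<bar>b - 1\<bar>"
    using b \<gamma> o by (simp_all add: abs_mult)
  note H = hellinger_integral_le_young_order[OF o \<gamma> _ b]
  show ?thesis
  proof (cases "hellinger_integral c P Q")
    case top
    then show ?thesis using abs(2) by (simp add: ln_ennreal_def)
  next
    case (real h)
    show ?thesis
    proof (cases "h = 0")
      case True
      \<comment> \<open>Here \<open>s\<close> cannot be the integral itself; letting
        \<open>s\<close> tend to 0 from the right forces the integral of order \<open>b\<close> to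
        vanish.\<close>
      have "((\<lambda>s. ennreal ((1 - \<gamma>) * s powr \<gamma>)) \<longlongrightarrow> ennreal ((1 - \<gamma>) * 0)) (at_right 0)"
        using \<gamma> by (intro tendsto_intros tendsto_ennrealI) real_asymp
      moreover have "eventually (\<lambda>s. hellinger_integral b P Q \<le> ennreal ((1 - \<gamma>) * s powr \<gamma>)) (at_right 0)"
        using H real True by (auto simp: eventually_at_right_less intro: eventually_at_rightI[of 0 1])
      ultimately have "hellinger_integral b P Q \<le> ennreal ((1 - \<gamma>) * 0)"
        by (intro tendsto_lowerbound) auto
      then show ?thesis using real True abs \<gamma> by (simp add: ln_ennreal_def)
    next
      case False
      then have h: "0 < h" using real by simp
      have "hellinger_integral b P Q \<le> ennreal (\<gamma> * h powr (\<gamma> - 1) * h + (1 - \<gamma>) * h powr \<gamma>)"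
        using H[OF h] \<gamma> h unfolding real by (simp flip: ennreal_mult ennreal_plus)
      also have "\<gamma> * h powr (\<gamma> - 1) * h + (1 - \<gamma>) * h powr \<gamma> = h powr \<gamma>"
        using h by (simp add: powr_diff algebra_simps)
      finally have "ln_ennreal (hellinger_integral b P Q) \<le> ln_ennreal (ennreal (h powr \<gamma>))"
        by (rule ln_ennreal_mono)
      also have "\<dots> = ereal (\<gamma> * ln h)" using h by (simp add: ln_ennreal_def ln_powr)
      finally have "ereal (1 / \<bar>b - 1\<bar>) * ln_ennreal (hellinger_integral b P Q)
          \<le> ereal (1 / \<bar>b - 1\<bar>) * ereal (\<gamma> * ln h)"
        by (intro ereal_mult_left_mono) auto
      also have "\<dots> = ereal (1 / \<bar>c - 1\<bar>) * ln_ennreal (hellinger_integral c P Q)"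
        using h \<gamma> abs(2) unfolding real abs(1) by (simp add: ln_ennreal_def)
      finally show ?thesis .
    qed
  qed
qed

text \<open>On either side of 1 the auxiliary inequality compares an order nearer to 1 with a more
  distant one. Below 1 the larger order is the nearer one and the prefactor is negative, and these
  two reversals cancel.\<close>

lemma (in prob_pair) renyi_simple_mono:
  assumes ab: "0 < a" "a \<le> b" and "b < 1 \<or> 1 < a"
  shows "renyi_simple a P Q \<le> renyi_simple b P Q"
proof (cases "a = b")
  case False
  show ?thesis
    using assms(3)
  proof
    assume b: "b < 1"
    have neg: "ereal (1 / (c - 1)) * z = - (ereal (1 / \<bar>c - 1\<bar>) * z)" if "c < 1" for c and z :: ereal
    proof -
      have "1 / (c - 1) = - (1 / \<bar>c - 1\<bar>)" using that by (simp add: field_simps)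
      then show ?thesis by (simp only: uminus_ereal.simps(1)[symmetric] ereal_mult_minus_left)
    qed
    have "ereal (1 / \<bar>b - 1\<bar>) * ln_ennreal (hellinger_integral b P Q)
      \<le> ereal (1 / \<bar>a - 1\<bar>) * ln_ennreal (hellinger_integral a P Q)"
      using False ab b by (intro renyi_simple_mono_aux[where \<gamma> = "(b - 1) / (a - 1)"]) (auto simp: field_simps)
    then show ?thesis using False ab b
      by (simp add: renyi_simple_hellinger neg del: times_ereal.simps)
  next
    assume a: "1 < a"
    have "ereal (1 / \<bar>a - 1\<bar>) * ln_ennreal (hellinger_integral a P Q)
      \<le> ereal (1 / \<bar>b - 1\<bar>) * ln_ennreal (hellinger_integral b P Q)"
      using False ab a by (intro renyi_simple_mono_aux[where \<gamma> = "(a - 1) / (b - 1)"]) (auto simp: field_simps)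
    then show ?thesis using False ab a by (simp add: renyi_simple_hellinger)
  qed
qed simp

text \<open>Monotonicity shows that the limit in the definition exists and turns it into a supremum,
  which can later be exchanged with the supremum over the filtration.\<close>

lemma (in prob_pair) renyi_divergence_one:
  "renyi_divergence 1 P Q = (SUP a\<in>{0<..<1}. renyi_simple a P Q)"
proof -
  have "((\<lambda>a. renyi_simple a P Q) \<longlongrightarrow> (SUP a\<in>{0<..<1}. renyi_simple a P Q)) (at_left 1)"
  proof (rule increasing_tendsto)
    show "\<forall>\<^sub>F a in at_left 1. renyi_simple a P Q \<le> (SUP a\<in>{0<..<1}. renyi_simple a P Q)"
      by (rule eventually_at_leftI[of 0]) (auto intro: SUP_upper)
    fix x assume "x < (SUP a\<in>{0<..<1}. renyi_simple a P Q)"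
    then obtain a where a: "a \<in> {0<..<1}" "x < renyi_simple a P Q" by (auto simp: less_SUP_iff)
    have "x < renyi_simple b P Q" if "b \<in> {a<..<1}" for b
      using a renyi_simple_mono[of a b] that by (auto intro: order.strict_trans2)
    then show "\<forall>\<^sub>F b in at_left 1. x < renyi_simple b P Q"
      using a(1) by (intro eventually_at_leftI[of a]) auto
  qed
  then show ?thesis by (simp add: renyi_divergence_def tendsto_Lim)
qed

lemma (in prob_pair) renyi_divergence_infinity:
  "renyi_divergence \<infinity> P Q = (SUP a\<in>{1<..}. renyi_simple a P Q)"
proof -
  have "((\<lambda>a. renyi_simple a P Q) \<longlongrightarrow> (SUP a\<in>{1<..}. renyi_simple a P Q)) at_top"
  proof (rule increasing_tendsto)
    show "\<forall>\<^sub>F a in at_top. renyi_simple a P Q \<le> (SUP a\<in>{1<..}. renyi_simple a P Q)"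
      using eventually_gt_at_top[of 1] by eventually_elim (auto intro: SUP_upper)
    fix x assume "x < (SUP a\<in>{1<..}. renyi_simple a P Q)"
    then obtain a where a: "1 < a" "x < renyi_simple a P Q" by (auto simp: less_SUP_iff)
    have "x < renyi_simple b P Q" if "a \<le> b" for b
      using a renyi_simple_mono[of a b] that by (auto intro: order.strict_trans2)
    then show "\<forall>\<^sub>F b in at_top. x < renyi_simple b P Q"
      by (rule eventually_at_top_linorderI)
  qed
  then show ?thesis by (simp add: renyi_divergence_def tendsto_Lim)
qed

lemma AE_sum_measureD:
  fixes P Q :: "'a measure"
  assumes "sets Q = sets P" "AE x in sum_measure P Q. R x"
  shows "AE x in P. R x" "AE x in Q. R x"
proof -
  obtain N where N: "{x \<in> space P. \<not> R x} \<subseteq> N" "N \<in> sets P" "emeasure (sum_measure P Q) N = 0"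
    using assms(2) by (auto elim!: AE_E)
  then have "emeasure P N = 0" "emeasure Q N = 0"
    by (simp_all add: emeasure_sum_measure[OF assms(1)])
  then show "AE x in P. R x" "AE x in Q. R x"
    using N assms(1) sets_eq_imp_space_eq[OF assms(1)] by (auto intro!: AE_I[where N = N])
qed

section \<open>L1 approximation along a filtration\<close>

locale finite_filtration = finite_measure M for M :: "'a measure" +
  fixes F :: "nat \<Rightarrow> 'a measure" and F_inf :: "'a measure"
  assumes subalg: "\<And>n. subalgebra M (F n)"
    and sets_F_Suc: "\<And>n. sets (F n) \<subseteq> sets (F (Suc n))"
    and F_inf: "F_inf = sigma (space M) (\<Union>n. sets (F n))"
begin

lemma sets_F_mono: "m \<le> n \<Longrightarrow> sets (F m) \<subseteq> sets (F n)"
  using sets_F_Suc by (rule lift_Suc_mono_le)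

lemma space_F [simp]: "space (F n) = space M"
  using subalg by (simp add: subalgebra_def)

lemma generator_subset: "(\<Union>n. sets (F n)) \<subseteq> Pow (space M)"
  using sets.sets_into_space by fastforce

lemma sets_F_inf: "sets F_inf = sigma_sets (space M) (\<Union>n. sets (F n))"
  unfolding F_inf using generator_subset by simp

lemma subalg_inf: "subalgebra M F_inf"
proof -
  have "(\<Union>n. sets (F n)) \<subseteq> sets M" using subalg by (auto simp: subalgebra_def)
  then have "sets F_inf \<subseteq> sets M" unfolding sets_F_inf by (rule sets.sigma_sets_subset)
  moreover have "space F_inf = space M" unfolding F_inf using generator_subset by simp
  ultimately show ?thesis by (simp add: subalgebra_def)
qed

lemma space_F_inf [simp]: "space F_inf = space M"
  using subalg_inf by (simp add: subalgebra_def)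

lemma subalg_F_inf: "subalgebra F_inf (F n)"
  by (auto simp: subalgebra_def sets_F_inf)

lemma F_measurable_mono: "m \<le> n \<Longrightarrow> f \<in> measurable (F m) N \<Longrightarrow> f \<in> measurable (F n) N"
  using sets_F_mono[of m n] by (auto simp: measurable_def)

text \<open>The L1 closure of the functions measurable at some stage. It has this meaning only for
  integrable \<open>f\<close>: the Bochner integral of a difference that is not integrable is
  \<open>0\<close> by default.\<close>

definition L1_approximable :: "('a \<Rightarrow> real) \<Rightarrow> bool" where
  "L1_approximable f \<longleftrightarrow> (\<forall>e>0. \<exists>n g. g \<in> borel_measurable (F n) \<and> integrable M g \<and> (\<integral>x. \<bar>f x - g x\<bar> \<partial>M) < e)"

lemma F_borel_measurable: "g \<in> borel_measurable (F n) \<Longrightarrow> g \<in> borel_measurable M"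
  using subalg measurable_from_subalg by blast

lemma L1_approximable_add:
  assumes f: "integrable M f" "L1_approximable f" and g: "integrable M g" "L1_approximable g"
  shows "L1_approximable (\<lambda>x. f x + g x)"
  unfolding L1_approximable_def
proof (intro allI impI)
  fix e :: real assume e: "0 < e"
  obtain n f' where f': "f' \<in> borel_measurable (F n)" "integrable M f'" "(\<integral>x. \<bar>f x - f' x\<bar> \<partial>M) < e / 2"
    using f(2) e unfolding L1_approximable_def by (meson half_gt_zero)
  obtain m g' where g': "g' \<in> borel_measurable (F m)" "integrable M g'" "(\<integral>x. \<bar>g x - g' x\<bar> \<partial>M) < e / 2"
    using g(2) e unfolding L1_approximable_def by (meson half_gt_zero)
  have "f' \<in> borel_measurable (F (max n m))" "g' \<in> borel_measurable (F (max n m))"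
    using f' g' F_measurable_mono[of n "max n m"] F_measurable_mono[of m "max n m"] by auto
  then have 1: "(\<lambda>x. f' x + g' x) \<in> borel_measurable (F (max n m))" by measurable
  have "(\<integral>x. \<bar>f x + g x - (f' x + g' x)\<bar> \<partial>M) \<le> (\<integral>x. \<bar>f x - f' x\<bar> + \<bar>g x - g' x\<bar> \<partial>M)"
    using f g f' g' by (intro integral_mono) auto
  also have "\<dots> = (\<integral>x. \<bar>f x - f' x\<bar> \<partial>M) + (\<integral>x. \<bar>g x - g' x\<bar> \<partial>M)"
    using f g f' g' by simp
  also have "\<dots> < e" using f' g' by simp
  finally show "\<exists>n h. h \<in> borel_measurable (F n) \<and> integrable M h \<and> (\<integral>x. \<bar>f x + g x - h x\<bar> \<partial>M) < e"
    using 1 f' g' by blast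
qed

lemma L1_approximable_lim:
  assumes f: "integrable M f" and s: "\<And>i. integrable M (s i)" "\<And>i. L1_approximable (s i)"
    and lim: "(\<lambda>i. \<integral>x. \<bar>f x - s i x\<bar> \<partial>M) \<longlonglongrightarrow> 0"
  shows "L1_approximable f"
  unfolding L1_approximable_def
proof (intro allI impI)
  fix e :: real assume e: "0 < e"
  then have "eventually (\<lambda>i. (\<integral>x. \<bar>f x - s i x\<bar> \<partial>M) < e / 2) sequentially"
    using lim by (intro order_tendstoD) auto
  then obtain i where i: "(\<integral>x. \<bar>f x - s i x\<bar> \<partial>M) < e / 2"
    by (auto dest: eventually_happens)
  obtain n g where g: "g \<in> borel_measurable (F n)" "integrable M g" "(\<integral>x. \<bar>s i x - g x\<bar> \<partial>M) < e / 2"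
    using s(2)[of i] e unfolding L1_approximable_def by (meson half_gt_zero)
  have "(\<integral>x. \<bar>f x - g x\<bar> \<partial>M) \<le> (\<integral>x. \<bar>f x - s i x\<bar> + \<bar>s i x - g x\<bar> \<partial>M)"
    using f g s by (intro integral_mono) auto
  also have "\<dots> = (\<integral>x. \<bar>f x - s i x\<bar> \<partial>M) + (\<integral>x. \<bar>s i x - g x\<bar> \<partial>M)"
    using f g s by simp
  also have "\<dots> < e" using i g by simp
  finally show "\<exists>n h. h \<in> borel_measurable (F n) \<and> integrable M h \<and> (\<integral>x. \<bar>f x - h x\<bar> \<partial>M) < e"
    using g by blast
qed

lemma L1_approximable_F:
  assumes "f \<in> borel_measurable (F n)" "integrable M f"
  shows "L1_approximable f"
  unfolding L1_approximable_def using assms by (intro allI impI exI[of _ n] exI[of _ f]) auto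

lemma L1_approximable_cmult:
  assumes f: "L1_approximable f"
  shows "L1_approximable (\<lambda>x. c * f x)"
proof (cases "c = 0")
  case True
  then show ?thesis by (auto intro: L1_approximable_F[of _ 0])
next
  case False
  show ?thesis
    unfolding L1_approximable_def
  proof (intro allI impI)
    fix e :: real assume e: "0 < e"
    with False have "0 < e / \<bar>c\<bar>" by simp
    then obtain n g where g: "g \<in> borel_measurable (F n)" "integrable M g" "(\<integral>x. \<bar>f x - g x\<bar> \<partial>M) < e / \<bar>c\<bar>"
      using f unfolding L1_approximable_def by blast
    have "(\<integral>x. \<bar>c * f x - c * g x\<bar> \<partial>M) = \<bar>c\<bar> * (\<integral>x. \<bar>f x - g x\<bar> \<partial>M)"
      by (subst integral_mult_right_zero[symmetric]) (simp add: abs_mult flip: right_diff_distrib)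
    also have "\<dots> < e" using g(3) False by (simp add: field_simps)
    finally show "\<exists>n h. h \<in> borel_measurable (F n) \<and> integrable M h \<and> (\<integral>x. \<bar>c * f x - h x\<bar> \<partial>M) < e"
      using g by (intro exI[of _ n] exI[of _ "\<lambda>x. c * g x"]) auto
  qed
qed

lemma tendsto_L1_dominated:
  fixes f :: "'a \<Rightarrow> real"
  assumes "integrable M w" "f \<in> borel_measurable M" "\<And>i. s i \<in> borel_measurable M"
    and "\<And>x. x \<in> space M \<Longrightarrow> (\<lambda>i. s i x) \<longlonglongrightarrow> f x"
    and "\<And>i x. x \<in> space M \<Longrightarrow> \<bar>f x - s i x\<bar> \<le> w x"
  shows "(\<lambda>i. \<integral>x. \<bar>f x - s i x\<bar> \<partial>M) \<longlonglongrightarrow> 0"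
proof -
  have "(\<lambda>i. \<integral>x. \<bar>f x - s i x\<bar> \<partial>M) \<longlonglongrightarrow> (\<integral>x. 0 \<partial>M)"
  proof (rule integral_dominated_convergence[where w = w])
    show "AE x in M. (\<lambda>i. \<bar>f x - s i x\<bar>) \<longlonglongrightarrow> 0"
      using assms(4) by (intro AE_I2 tendsto_rabs_zero) (auto intro!: LIM_zero tendsto_eq_intros)
  qed (use assms in auto)
  then show ?thesis by simp
qed

lemma Int_stable_generator: "Int_stable (\<Union>n. sets (F n))"
proof (rule Int_stableI)
  fix A B assume "A \<in> (\<Union>n. sets (F n))" "B \<in> (\<Union>n. sets (F n))"
  then obtain m n where "A \<in> sets (F m)" "B \<in> sets (F n)" by auto
  then have "A \<inter> B \<in> sets (F (max m n))"
    using sets_F_mono[of m "max m n"] sets_F_mono[of n "max m n"] by auto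
  then show "A \<inter> B \<in> (\<Union>n. sets (F n))" by blast
qed

text \<open>Dynkin's argument: the union of the stages is stable under intersection, and
  approximability passes to complements by linearity and to disjoint unions by dominated
  convergence.\<close>

lemma L1_approximable_indicator:
  assumes "A \<in> sets F_inf"
  shows "L1_approximable (indicator A)"
  using Int_stable_generator generator_subset assms[unfolded sets_F_inf]
proof (induction rule: sigma_sets_induct_disjoint)
  case (basic A)
  then obtain n where n: "A \<in> sets (F n)" by auto
  then have "A \<in> sets M" using subalg by (auto simp: subalgebra_def)
  then show ?case using n by (intro L1_approximable_F[of _ n]) (auto simp: less_top[symmetric])
next
  case empty
  then show ?case by (intro L1_approximable_F[of _ 0]) auto
next
  case (compl A)
  have A: "A \<in> sets M" using compl(1) sets_F_inf subalg_inf by (auto simp: subalgebra_def)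
  then have int: "integrable M (indicat_real A)" by (simp add: less_top[symmetric])
  \<comment> \<open>This function agrees with the indicator of the complement only on
    \<open>space M\<close>, so the two are identified under the integral.\<close>
  have "L1_approximable (\<lambda>x. 1 + (-1) * indicator A x)"
    using compl(2) int
    by (intro L1_approximable_add L1_approximable_cmult L1_approximable_F[of "\<lambda>_. 1" 0]) auto
  moreover have "(\<integral>x. \<bar>1 + (-1) * indicator A x - g x\<bar> \<partial>M) = (\<integral>x. \<bar>indicator (space M - A) x - g x\<bar> \<partial>M)" for g :: "'a \<Rightarrow> real"
    by (intro Bochner_Integration.integral_cong) (auto simp: indicator_def)
  ultimately show ?case
    unfolding L1_approximable_def by simp
next
  case (union A)
  have A: "A i \<in> sets M" for i using union(2) sets_F_inf subalg_inf by (auto simp: subalgebra_def)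
  then have int: "integrable M (indicat_real (A i))" for i by (simp add: less_top[symmetric])
  have sums: "L1_approximable (\<lambda>x. \<Sum>i<k. indicat_real (A i) x)" for k
  proof (induction k)
    case 0
    show ?case by (auto intro: L1_approximable_F[of _ 0])
  next
    case (Suc k)
    then show ?case using int union(3) by (simp, intro L1_approximable_add) auto
  qed
  have U: "(\<Union>i. A i) \<in> sets M" using A by blast
  \<comment> \<open>Disjointness makes the partial sums indicators, which are bounded by 1 and
    converge pointwise.\<close>
  have eq: "(\<Sum>i<k. indicat_real (A i) x) = indicator (\<Union>i<k. A i) x" for k x
    using union(1) by (subst indicator_UN_disjoint) (auto simp: disjoint_family_on_def)
  show ?case
  proof (rule L1_approximable_lim[OF _ _ sums])
    show "(\<lambda>k. \<integral>x. \<bar>indicator (\<Union>i. A i) x - (\<Sum>i<k. indicat_real (A i) x)\<bar> \<partial>M) \<longlonglongrightarrow> 0"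
    proof (rule tendsto_L1_dominated[where w = "\<lambda>_. 1"])
      show "(\<lambda>k. \<Sum>i<k. indicat_real (A i) x) \<longlonglongrightarrow> indicator (\<Union>i. A i) x" for x
        unfolding eq by (rule LIMSEQ_indicator_UN)
      show "\<bar>indicator (\<Union>i. A i) x - (\<Sum>i<k. indicat_real (A i) x)\<bar> \<le> 1" for x k
        unfolding eq by (auto simp: indicator_def)
    qed (use int U in auto)
  qed (use int U in \<open>auto simp: less_top[symmetric]\<close>)
qed

text \<open>The induction runs over integrable functions for the measure restricted to
  \<open>F_inf\<close>, so that its base case concerns only sets of \<open>F_inf\<close>.\<close>

lemma L1_approximable_integrable:
  assumes "f \<in> borel_measurable F_inf" "integrable M f"
  shows "L1_approximable f"
proof -
  have "integrable (restr_to_subalg M F_inf) f"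
    using assms by (intro integrable_in_subalg subalg_inf)
  then show ?thesis
  proof (induction rule: integrable_induct)
    case (base A c)
    then have "A \<in> sets F_inf" by (simp add: sets_restr_to_subalg[OF subalg_inf])
    then show ?case
      using L1_approximable_cmult[OF L1_approximable_indicator, of A c] by (simp add: mult.commute)
  next
    case (add f g)
    then show ?case using integrable_from_subalg[OF subalg_inf] by (intro L1_approximable_add) auto
  next
    case (lim f s)
    have int: "integrable M f" "integrable M (s i)" for i
      using lim integrable_from_subalg[OF subalg_inf] by blast+
    have bound: "\<bar>s i x\<bar> \<le> 2 * \<bar>f x\<bar>" and pointwise: "(\<lambda>i. s i x) \<longlonglongrightarrow> f x"
      if "x \<in> space M" for i x
      using lim that by (simp_all add: space_restr_to_subalg)
    show ?case
    proof (rule L1_approximable_lim[OF int(1), where s = s])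
      show "(\<lambda>i. \<integral>x. \<bar>f x - s i x\<bar> \<partial>M) \<longlonglongrightarrow> 0"
      \<comment> \<open>The induction supplies
        \<open>\<bar>s i x\<bar> \<le> 2 * \<bar>f x\<bar>\<close>, hence the factor 3.\<close>
      proof (rule tendsto_L1_dominated[where w = "\<lambda>x. 3 * \<bar>f x\<bar>"])
        show "\<bar>f x - s i x\<bar> \<le> 3 * \<bar>f x\<bar>" if "x \<in> space M" for i x
          using bound[OF that, of i] by linarith
      qed (use int pointwise in auto)
    next
      show "integrable M (s i)" for i by (rule int)
      show "L1_approximable (s i)" for i by (rule lim.IH)
    qed
  qed
qed

text \<open>L1 approximants with errors below \<open>1 / real (Suc i)\<close> are clamped to the
  bounds of \<open>t\<close>, and a subsequence converges almost everywhere. This takes the place of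
  martingale convergence; the stages \<open>n i\<close> need not increase.\<close>

lemma test_fns_approx:
  assumes t: "t \<in> test_fns F_inf"
  obtains K n s where "0 < K" "\<And>i. s i \<in> borel_measurable (F (n i))"
    "\<And>i x. x \<in> space M \<Longrightarrow> 1 / K \<le> s i x" "\<And>i x. x \<in> space M \<Longrightarrow> s i x \<le> K"
    "AE x in M. (\<lambda>i. s i x) \<longlonglongrightarrow> t x"
proof -
  obtain K where K: "0 < K" "\<And>x. x \<in> space M \<Longrightarrow> 1 / K \<le> t x" "\<And>x. x \<in> space M \<Longrightarrow> t x \<le> K"
    "t \<in> borel_measurable F_inf"
    using t by (elim test_fnsE) simp
  have tM: "t \<in> borel_measurable M" using K(4) subalg_inf measurable_from_subalg by blast
  have "0 < 1 / K" using K(1) by simp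
  then have bnd: "\<bar>u\<bar> \<le> K" if "1 / K \<le> u" "u \<le> K" for u
    using that by linarith
  have "integrable M t"
    using tM by (intro integrable_const_bound[where B = K] AE_I2) (simp_all add: K bnd)
  then have "L1_approximable t" by (rule L1_approximable_integrable[OF K(4)])
  then have "\<exists>n g. g \<in> borel_measurable (F n) \<and> integrable M g \<and> (\<integral>x. \<bar>t x - g x\<bar> \<partial>M) < 1 / real (Suc i)" for i
    unfolding L1_approximable_def by simp
  then obtain n g where g: "\<And>i. g i \<in> borel_measurable (F (n i))" "\<And>i. integrable M (g i)"
    "\<And>i. (\<integral>x. \<bar>t x - g i x\<bar> \<partial>M) < 1 / real (Suc i)" by metis
  \<comment> \<open>Clamping to an interval that contains the values of \<open>t\<close> does not
    increase the distance to \<open>t\<close>.\<close>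
  define s where "s i x = max (1 / K) (min K (g i x))" for i x
  \<comment> \<open>The upper bound relies on \<open>1 / K \<le> K\<close>, which follows from the
    bounds on \<open>t x\<close> at a point \<open>x\<close> of the space.\<close>
  have lower_upper: "1 / K \<le> s i x" "x \<in> space M \<Longrightarrow> s i x \<le> K" for i x
    using K(2,3)[of x] unfolding s_def by auto
  have [measurable]: "s i \<in> borel_measurable (F (n i))" for i
    unfolding s_def[abs_def] using g(1)[of i] by measurable
  have sM: "s i \<in> borel_measurable M" for i by (rule F_borel_measurable) fact
  have ints: "integrable M (s i)" for i
    using sM by (intro integrable_const_bound[where B = K] AE_I2) (simp_all add: lower_upper bnd)
  have "(\<lambda>i. \<integral>x. norm (s i x - t x) \<partial>M) \<longlonglongrightarrow> 0"
  proof (rule tendsto_sandwich[OF _ _ tendsto_const LIMSEQ_Suc[OF lim_1_over_n]])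
    have "(\<integral>x. norm (s i x - t x) \<partial>M) \<le> 1 / real (Suc i)" for i
    proof -
      have "(\<integral>x. norm (s i x - t x) \<partial>M) \<le> (\<integral>x. \<bar>t x - g i x\<bar> \<partial>M)"
      proof (intro integral_mono)
        show "norm (s i x - t x) \<le> \<bar>t x - g i x\<bar>" if "x \<in> space M" for x
          using K(2,3)[OF that] unfolding s_def by (auto simp: abs_if max_def min_def)
      qed (use g ints \<open>integrable M t\<close> in auto)
      with g(3)[of i] show ?thesis by simp
    qed
    then show "\<forall>\<^sub>F i in sequentially. (\<integral>x. norm (s i x - t x) \<partial>M) \<le> 1 / of_nat (Suc i)" by simp
  qed simp
  moreover have "integrable M (\<lambda>x. s i x - t x)" for i using ints \<open>integrable M t\<close> by simp
  ultimately obtain r where "AE x in M. (\<lambda>i. s (r i) x - t x) \<longlonglongrightarrow> 0"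
    using tendsto_L1_AE_subseq[where M = M and u = "\<lambda>i x. s i x - t x"] by blast
  then have r: "AE x in M. (\<lambda>i. s (r i) x) \<longlonglongrightarrow> t x"
    by eventually_elim (rule LIM_zero_cancel)
  show ?thesis
    by (rule that[of K "\<lambda>i. s (r i)" "\<lambda>i. n (r i)"]) (use K(1) lower_upper r in auto)
qed

end

section \<open>Restriction to a sub-sigma-algebra\<close>

lemma test_fns_mono:
  assumes "subalgebra N G" shows "test_fns G \<subseteq> test_fns N"
proof -
  have "space G = space N" using assms by (simp add: subalgebra_def)
  then show ?thesis unfolding test_fns_def using measurable_from_subalg[OF assms] by auto
qed

context prob_pair
begin

lemma subalg_Q: "subalgebra P G \<Longrightarrow> subalgebra Q G"
  by (simp add: subalgebra_def sets_Q space_Q)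

lemma prob_pair_restr:
  assumes "subalgebra P G"
  shows "prob_pair (restr_to_subalg P G) (restr_to_subalg Q G)"
  using assms subalg_Q[OF assms] P.prob_space_axioms Q.prob_space_axioms
  by (intro prob_pair.intro prob_pair_axioms.intro prob_space_restr_to_subalg)
    (simp_all add: sets_restr_to_subalg)

lemma test_fns_restr:
  assumes "subalgebra P G"
  shows "test_fns (restr_to_subalg P G) = test_fns G"
proof -
  have "borel_measurable (restr_to_subalg P G) = (borel_measurable G :: ('a \<Rightarrow> real) set)"
    using assms by (intro measurable_cong_sets) (simp_all add: sets_restr_to_subalg)
  then show ?thesis
    using assms by (simp add: test_fns_def space_restr_to_subalg subalgebra_def)
qed

lemma young_functional_restr:
  assumes "subalgebra P G" "t \<in> test_fns G"
  shows "young_functional a (restr_to_subalg P G) (restr_to_subalg Q G) t = young_functional a P Q t"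
proof -
  have [measurable]: "t \<in> borel_measurable G" using assms by (simp add: test_fns_def)
  show ?thesis
    unfolding young_functional_def
    using assms(1) subalg_Q[OF assms(1)] by (simp add: integral_subalgebra2)
qed

text \<open>The functional is that of the unrestricted pair and only the index set depends on
  \<open>G\<close>, so sigma-algebras can be compared by inclusion of their competitors.\<close>

lemma hellinger_integral_restr_INF:
  assumes "subalgebra P G" "0 < a" "a < 1"
  shows "hellinger_integral a (restr_to_subalg P G) (restr_to_subalg Q G)
    = (INF t\<in>test_fns G. ennreal (young_functional a P Q t))"
  unfolding prob_pair.hellinger_integral_eq_INF[OF prob_pair_restr[OF assms(1)] assms(2,3)] test_fns_restr[OF assms(1)]
  by (intro INF_cong refl) (simp add: young_functional_restr[OF assms(1)])

lemma hellinger_integral_restr_SUP: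
  assumes "subalgebra P G" "1 < a"
  shows "hellinger_integral a (restr_to_subalg P G) (restr_to_subalg Q G)
    = (SUP t\<in>test_fns G. ennreal (young_functional a P Q t))"
  unfolding prob_pair.hellinger_integral_eq_SUP[OF prob_pair_restr[OF assms(1)] assms(2)] test_fns_restr[OF assms(1)]
  by (intro SUP_cong refl) (simp add: young_functional_restr[OF assms(1)])

end

section \<open>Convergence along the filtration\<close>

locale prob_pair_filtration = prob_pair P Q for P Q :: "'a measure" +
  fixes F :: "nat \<Rightarrow> 'a measure" and F_inf :: "'a measure"
  assumes subalg_P: "\<And>n. subalgebra P (F n)"
    and sets_F_Suc: "\<And>n. sets (F n) \<subseteq> sets (F (Suc n))"
    and F_inf: "F_inf = sigma (space P) (\<Union>n. sets (F n))"
begin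

text \<open>With the sum of \<open>P\<close> and \<open>Q\<close> as base measure, almost everywhere
  convergence holds under both simultaneously.\<close>

sublocale filt: finite_filtration \<mu> F F_inf
  using subalg_P sets_F_Suc F_inf by unfold_locales (auto simp: subalgebra_def)

lemma subalg_P_inf: "subalgebra P F_inf"
  using filt.subalg_inf by (simp add: subalgebra_def)

lemma subalg_F_Suc: "subalgebra (F (Suc n)) (F n)"
  using sets_F_Suc by (simp add: subalgebra_def)

text \<open>The bounds on the approximants are uniform in \<open>i\<close>, so a constant dominates
  their powers and both integrals converge along one sequence.\<close>

lemma young_functional_approx:
  assumes t: "t \<in> test_fns F_inf"
  obtains n s where "\<And>i. s i \<in> test_fns (F (n i))"
    "(\<lambda>i. young_functional a P Q (s i)) \<longlonglongrightarrow> young_functional a P Q t"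
proof -
  obtain K n s where s: "0 < K" "\<And>i. s i \<in> borel_measurable (F (n i))"
    "\<And>i x. x \<in> space P \<Longrightarrow> 1 / K \<le> s i x" "\<And>i x. x \<in> space P \<Longrightarrow> s i x \<le> K"
    "AE x in \<mu>. (\<lambda>i. s i x) \<longlonglongrightarrow> t x"
    by (rule filt.test_fns_approx[OF t, unfolded space_\<mu>]) blast
  have test: "s i \<in> test_fns (F (n i))" for i
    using s by (auto simp: test_fns_def)
  have t_pos: "0 < t x" if "x \<in> space P" for x using test_fns_pos[OF t] that by simp
  have tP: "t \<in> borel_measurable P"
    using t subalg_P_inf measurable_from_subalg by (auto simp: test_fns_def)
  have sP: "s i \<in> borel_measurable P" for i
    using s(2) subalg_P measurable_from_subalg by blast
  have AE: "AE x in P. (\<lambda>i. s i x) \<longlonglongrightarrow> t x" "AE x in Q. (\<lambda>i. s i x) \<longlonglongrightarrow> t x"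
    using AE_sum_measureD[OF sets_Q] s(5) unfolding \<mu>_def by blast+
  have lim: "(\<lambda>i. \<integral>x. s i x powr b \<partial>R) \<longlonglongrightarrow> (\<integral>x. t x powr b \<partial>R)"
    if R: "prob_space R" "sets R = sets P" "AE x in R. (\<lambda>i. s i x) \<longlonglongrightarrow> t x" for R b
  proof -
    interpret R: prob_space R by fact
    have sp: "space R = space P" using R(2) by (rule sets_eq_imp_space_eq)
    have [measurable]: "t \<in> borel_measurable R" "s i \<in> borel_measurable R" for i
      using tP sP R(2) measurable_cong_sets by blast+
    show ?thesis
    proof (rule integral_dominated_convergence[where w = "\<lambda>_. max (K powr b) ((1 / K) powr b)"])
      show "AE x in R. (\<lambda>i. s i x powr b) \<longlonglongrightarrow> t x powr b"
        using R(3) AE_space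
      proof eventually_elim
        case (elim x)
        \<comment> \<open>Positivity of \<open>t x\<close> makes the power continuous there for
          every exponent.\<close>
        then show ?case using t_pos[of x] by (intro tendsto_powr tendsto_const) (auto simp: sp)
      qed
      show "AE x in R. norm (s i x powr b) \<le> max (K powr b) ((1 / K) powr b)" for i
        using s(1,3,4) by (intro AE_I2) (simp add: sp powr_le_of_bounds del: le_max_iff_disj)
    qed auto
  qed
  have "(\<lambda>i. young_functional a P Q (s i)) \<longlonglongrightarrow> young_functional a P Q t"
    unfolding young_functional_def
    using lim[OF P.prob_space_axioms refl AE(1)] lim[OF Q.prob_space_axioms sets_Q AE(2)]
    by (intro tendsto_intros)
  with test show ?thesis by (rule that)
qed

definition hellinger_restr :: "real \<Rightarrow> 'a measure \<Rightarrow> ennreal" where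
  "hellinger_restr a G = hellinger_integral a (restr_to_subalg P G) (restr_to_subalg Q G)"

text \<open>Competitors accumulate with \<open>n\<close>, so the infima decrease. The value at a
  competitor for \<open>F_inf\<close> is a limit of values at competitors for finite stages, none of
  which is below the infimum over \<open>n\<close>.\<close>

lemma hellinger_restr_less_one:
  assumes a: "0 < a" "a < 1"
  shows "decseq (\<lambda>n. hellinger_restr a (F n))" "(\<lambda>n. hellinger_restr a (F n)) \<longlonglongrightarrow> hellinger_restr a F_inf"
proof -
  note eq = hellinger_integral_restr_INF[OF _ a, folded hellinger_restr_def]
  show dec: "decseq (\<lambda>n. hellinger_restr a (F n))"
    unfolding eq[OF subalg_P]
    by (intro decseq_SucI INF_superset_mono test_fns_mono subalg_F_Suc) simp
  have "(INF n. hellinger_restr a (F n)) = hellinger_restr a F_inf"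
  proof (rule antisym)
    show "hellinger_restr a F_inf \<le> (INF n. hellinger_restr a (F n))"
      unfolding eq[OF subalg_P] eq[OF subalg_P_inf]
      by (intro INF_greatest[of UNIV] INF_superset_mono test_fns_mono filt.subalg_F_inf) simp
    show "(INF n. hellinger_restr a (F n)) \<le> hellinger_restr a F_inf"
      unfolding eq[OF subalg_P_inf]
    proof (rule INF_greatest)
      fix t assume "t \<in> test_fns F_inf"
      then obtain n s where s: "\<And>i. s i \<in> test_fns (F (n i))"
        "(\<lambda>i. young_functional a P Q (s i)) \<longlonglongrightarrow> young_functional a P Q t"
        by (rule young_functional_approx[where a = a]) blast
      have "(INF n. hellinger_restr a (F n)) \<le> ennreal (young_functional a P Q (s i))" for i
        using INF_lower[of "n i" UNIV "\<lambda>n. hellinger_restr a (F n)"] INF_lower[OF s(1)]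
        unfolding eq[OF subalg_P] by (meson UNIV_I order_trans)
      then show "(INF n. hellinger_restr a (F n)) \<le> ennreal (young_functional a P Q t)"
        by (intro LIMSEQ_le_const[OF tendsto_ennrealI[OF s(2)]]) auto
    qed
  qed
  then show "(\<lambda>n. hellinger_restr a (F n)) \<longlonglongrightarrow> hellinger_restr a F_inf" using LIMSEQ_INF[OF dec] by simp
qed

lemma hellinger_restr_greater_one:
  assumes a: "1 < a"
  shows "incseq (\<lambda>n. hellinger_restr a (F n))" "(\<lambda>n. hellinger_restr a (F n)) \<longlonglongrightarrow> hellinger_restr a F_inf"
proof -
  note eq = hellinger_integral_restr_SUP[OF _ a, folded hellinger_restr_def]
  show inc: "incseq (\<lambda>n. hellinger_restr a (F n))"
    unfolding eq[OF subalg_P]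
    by (intro incseq_SucI SUP_subset_mono test_fns_mono subalg_F_Suc) simp
  have "(SUP n. hellinger_restr a (F n)) = hellinger_restr a F_inf"
  proof (rule antisym)
    show "(SUP n. hellinger_restr a (F n)) \<le> hellinger_restr a F_inf"
      unfolding eq[OF subalg_P] eq[OF subalg_P_inf]
      by (intro SUP_least[of UNIV] SUP_subset_mono test_fns_mono filt.subalg_F_inf) simp
    show "hellinger_restr a F_inf \<le> (SUP n. hellinger_restr a (F n))"
      unfolding eq[OF subalg_P_inf]
    proof (rule SUP_least)
      fix t assume "t \<in> test_fns F_inf"
      then obtain n s where s: "\<And>i. s i \<in> test_fns (F (n i))"
        "(\<lambda>i. young_functional a P Q (s i)) \<longlonglongrightarrow> young_functional a P Q t"
        by (rule young_functional_approx[where a = a]) blast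
      have "ennreal (young_functional a P Q (s i)) \<le> (SUP n. hellinger_restr a (F n))" for i
        using SUP_upper[of "n i" UNIV "\<lambda>n. hellinger_restr a (F n)"] SUP_upper[OF s(1)]
        unfolding eq[OF subalg_P] by (meson UNIV_I order_trans)
      then show "ennreal (young_functional a P Q t) \<le> (SUP n. hellinger_restr a (F n))"
        by (intro LIMSEQ_le_const2[OF tendsto_ennrealI[OF s(2)]]) auto
    qed
  qed
  then show "(\<lambda>n. hellinger_restr a (F n)) \<longlonglongrightarrow> hellinger_restr a F_inf" using LIMSEQ_SUP[OF inc] by simp
qed

definition renyi_restr :: "real \<Rightarrow> 'a measure \<Rightarrow> ereal" where
  "renyi_restr a G = renyi_simple a (restr_to_subalg P G) (restr_to_subalg Q G)"

lemma renyi_restr_eq: "renyi_restr a G = ereal (1 / (a - 1)) * ln_ennreal (hellinger_restr a G)"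
  by (simp add: renyi_restr_def hellinger_restr_def renyi_simple_hellinger)

lemma renyi_restr_tendsto:
  assumes "0 < a" "a \<noteq> 1"
  shows "(\<lambda>n. renyi_restr a (F n)) \<longlonglongrightarrow> renyi_restr a F_inf"
proof -
  have "(\<lambda>n. hellinger_restr a (F n)) \<longlonglongrightarrow> hellinger_restr a F_inf"
    using assms hellinger_restr_less_one(2) hellinger_restr_greater_one(2) by (cases "a < 1") auto
  then show ?thesis unfolding renyi_restr_eq by (intro tendsto_cmult_ereal tendsto_ln_ennreal) auto
qed

text \<open>Below order 1 a decreasing Hellinger integral meets a negative prefactor; above 1 the
  integral increases and the prefactor is positive.\<close>

lemma renyi_restr_incseq:
  assumes "0 < a" "a \<noteq> 1"
  shows "incseq (\<lambda>n. renyi_restr a (F n))"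
proof (cases "a < 1")
  case True
  have "ereal (1 / (a - 1)) * z = - (ereal (1 / (1 - a)) * z)" for z :: ereal
  proof -
    have "1 / (a - 1) = - (1 / (1 - a))" using True by (simp add: field_simps)
    then show ?thesis by (simp only: uminus_ereal.simps(1)[symmetric] ereal_mult_minus_left)
  qed
  then show ?thesis
    using hellinger_restr_less_one(1)[OF assms(1) True] True
    by (auto simp: renyi_restr_eq incseq_def decseq_def intro!: ereal_mult_left_mono ln_ennreal_mono)
next
  case False
  then show ?thesis
    using hellinger_restr_greater_one(1)[of a] assms
    by (auto simp: renyi_restr_eq incseq_def intro!: ereal_mult_left_mono ln_ennreal_mono)
qed

text \<open>For each order the limit over \<open>n\<close> is a supremum, and suprema commute. The
  sets \<open>{0<..<1}\<close> and \<open>{1<..}\<close> serve the orders 1 and \<infinity>.\<close>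

lemma SUP_renyi_restr_tendsto:
  assumes "A \<subseteq> {0<..} - {1}"
  shows "(\<lambda>n. SUP a\<in>A. renyi_restr a (F n)) \<longlonglongrightarrow> (SUP a\<in>A. renyi_restr a F_inf)"
proof -
  have "(SUP n. renyi_restr a (F n)) = renyi_restr a F_inf" if "a \<in> A" for a
    using that assms renyi_restr_incseq[of a] renyi_restr_tendsto[of a] LIMSEQ_SUP LIMSEQ_unique by blast
  then have "(SUP a\<in>A. renyi_restr a F_inf) = (SUP a\<in>A. SUP n. renyi_restr a (F n))"
    by (intro SUP_cong) auto
  also have "\<dots> = (SUP n. SUP a\<in>A. renyi_restr a (F n))" by (rule SUP_commute)
  finally have eq: "(SUP a\<in>A. renyi_restr a F_inf) = (SUP n. SUP a\<in>A. renyi_restr a (F n))" .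
  have "incseq (\<lambda>n. SUP a\<in>A. renyi_restr a (F n))"
  proof (intro incseq_SucI SUP_subset_mono[OF subset_refl])
    fix n a assume "a \<in> A"
    then show "renyi_restr a (F n) \<le> renyi_restr a (F (Suc n))"
      using assms by (intro incseq_SucD renyi_restr_incseq) auto
  qed
  then show ?thesis unfolding eq by (rule LIMSEQ_SUP)
qed

lemma renyi_divergence_restr_tendsto:
  assumes "0 < \<alpha>"
  shows "(\<lambda>n. renyi_divergence \<alpha> (restr_to_subalg P (F n)) (restr_to_subalg Q (F n)))
    \<longlonglongrightarrow> renyi_divergence \<alpha> (restr_to_subalg P F_inf) (restr_to_subalg Q F_inf)"
proof -
  note pairs = prob_pair_restr[OF subalg_P] prob_pair_restr[OF subalg_P_inf]
  consider "\<alpha> = 1" | "\<alpha> = \<infinity>" | a where "\<alpha> = ereal a" "0 < a" "a \<noteq> 1"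
    using assms by (cases \<alpha>) (auto simp: one_ereal_def)
  then show ?thesis
  proof cases
    case 1
    have "{0<..<1} \<subseteq> {0<..} - {1 :: real}" by auto
    from SUP_renyi_restr_tendsto[OF this] show ?thesis
      unfolding 1 renyi_restr_def by (simp only: pairs[THEN prob_pair.renyi_divergence_one])
  next
    case 2
    have "{1<..} \<subseteq> {0<..} - {1 :: real}" by auto
    from SUP_renyi_restr_tendsto[OF this] show ?thesis
      unfolding 2 renyi_restr_def by (simp only: pairs[THEN prob_pair.renyi_divergence_infinity])
  next
    case 3
    then show ?thesis
      using renyi_restr_tendsto[of a] by (simp add: renyi_divergence_def renyi_restr_def one_ereal_def)
  qed
qed

end

theorem theorem21:
  fixes M P Q F_inf :: "'a measure" and F :: "nat \<Rightarrow> 'a measure" and \<alpha> :: ereal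
  assumes "prob_space P" "sets P = sets M"
    and "prob_space Q" "sets Q = sets M"
    and "\<And>n. subalgebra M (F n)"
    and "\<And>n. sets (F n) \<subseteq> sets (F (Suc n))"
    and "F_inf = sigma (space M) (\<Union>n. sets (F n))"
    and "0 < \<alpha>"
  shows "(\<lambda>n. renyi_divergence \<alpha> (restr_to_subalg P (F n)) (restr_to_subalg Q (F n)))
           \<longlonglongrightarrow> renyi_divergence \<alpha> (restr_to_subalg P F_inf) (restr_to_subalg Q F_inf)"
proof -
  have "space P = space M" using assms(2) by (rule sets_eq_imp_space_eq)
  \<comment> \<open>The locale takes its ambient sigma-algebra from \<open>P\<close>, which agrees
    with that of \<open>M\<close> in both space and sets.\<close>
  then have "prob_pair_filtration P Q F F_inf"
    using assms
    by (intro prob_pair_filtration.intro prob_pair.intro prob_pair_axioms.intro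
        prob_pair_filtration_axioms.intro) (auto simp: subalgebra_def)
  then show ?thesis using assms(8) by (rule prob_pair_filtration.renyi_divergence_restr_tendsto)
qed

end
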